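(* Let $q$ be an odd prime power, let $\varnothing\ne\Omega\subset\mathcal{D}_1$, and let $E\subset\mathbb{H}_1(\mathbb{F}_q)$. Let $m$ be an integer with $1\le m\le q$. Assume that for every $\omega\in\Omega$ there exists a horizontal line $L\subset\mathbb{H}_1(\mathbb{F}_q)$ such that $\mathrm{Dir}(L)=\omega$ and $|E\cap L|\ge m$. Then for $1\le u<\infty$ and $1\le v\le\infty$ we have $$|E|\ \gtrsim_{u,v}\ m^{u}\,|\Omega|^{\frac{u}{v}}\,q^{-u\,A^{\mathrm{rd}}_1(u,v)}.$$ In particular, for $(u,v)=(2,2)$, one has $$|E|\ \gtrsim\ \frac{m^2\,|\Omega|}{q}.$$ Hence, any full-direction horizontal Heisenberg Kakeya set in $\mathbb{H}_1(\mathbb{F}_q)$ has size $\gtrsim q^3$.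
   Context: $\mathbb{F}_q$ is the field with $q$ elements. The Heisenberg group $\mathbb{H}_1(\mathbb{F}_q)$ is the set $\mathbb{F}_q^3$ with group law $(x,y,t)\cdot(x',y',t')=(x+x',\,y+y',\,t+t'+(xy'-yx'))$. A horizontal line is a set of the form $\{(x_0,y_0,t_0)\cdot(sa,sb,0):s\in\mathbb{F}_q\}=\{(x_0+sa,\,y_0+sb,\,t_0+s(x_0b-y_0a)):s\in\mathbb{F}_q\}$ with $(x_0,y_0,t_0)\in\mathbb{H}_1(\mathbb{F}_q)$ and $(a,b)\in\mathbb{F}_q^2\setminus\{(0,0)\}$. The refined direction set is $\mathcal{D}_1=\{[a:b:c]\in\mathbb{P}^2(\mathbb{F}_q):(a,b)\ne(0,0)\}$. The refined direction of the horizontal line $L$ above is $\mathrm{Dir}(L)=[a:b:x_0b-y_0a]\in\mathcal{D}_1$ (independent of the choice of the point $(x_0,y_0,t_0)\in L$ and of the representative $(a,b)$). A set $E\subset\mathbb{H}_1(\mathbb{F}_q)$ is a full-direction horizontal Heisenberg Kakeya set if for every $\omega\in\mathcal{D}_1$ there exists a horizontal line $L\subset E$ with $\mathrm{Dir}(L)=\omega$. For $F:\mathbb{H}_1(\mathbb{F}_q)\to\mathbb{C}$ and $\omega\in\mathcal{D}_1$, put $(\mathcal{M}^{\mathrm{rd}}_{\mathbb{H}_1}F)(\omega):=\max\{\sum_{\mathbf{p}\in L}|F(\mathbf{p})|: L\text{ horizontal},\ \mathrm{Dir}(L)=\omega\}$. For $1\le u,v\le\infty$, $A^{\mathrm{rd}}_1(u,v)$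 is the smallest non-negative real number, independent of the field size, such that there exists $C_{u,v}>0$ with $\|\mathcal{M}^{\mathrm{rd}}_{\mathbb{H}_1}F\|_{\ell^v(\mathcal{D}_1)}\le C_{u,v}\,q^{A^{\mathrm{rd}}_1(u,v)}\,\|F\|_{\ell^u(\mathbb{H}_1(\mathbb{F}_q))}$ for all odd prime powers $q$ and all $F:\mathbb{H}_1(\mathbb{F}_q)\to\mathbb{C}$; the norms are $\ell^p$-norms with respect to counting measure. Notation: $X\gtrsim_{u,v}Y$ means $X\ge cY$ for some constant $c>0$ depending only on $u,v$ (not on $q,m,\Omega,E$); $X\gtrsim Y$ means the same with an absolute constant $c>0$. Convention: $1/\infty=0$, so $|\Omega|^{u/\infty}=1$. *)

theory Defs
  imports
    Complex_Main
    "HOL-Library.Extended_Nonnegative_Real"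
    "HOL-Algebra.Ring"
    "HOL-Algebra.Coset"
begin

text \<open>
  Bounds below have to be uniform over all finite fields, so the fields are \<open>HOL-Algebra\<close> rings
  (objects one can quantify over) rather than types. Statements ranging over all fields use
  rings on carriers of natural numbers; every finite field is isomorphic to one of these.
\<close>

text \<open>The order of a finite field is always a prime power, so only its parity is prescribed.\<close>

definition odd_finite_field :: "('a, 'b) ring_scheme \<Rightarrow> bool" where
  "odd_finite_field R \<longleftrightarrow> field R \<and> finite (carrier R) \<and> odd (order R)"

definition heisenberg :: "('a, 'b) ring_scheme \<Rightarrow> ('a \<times> 'a \<times> 'a) monoid" where
  "heisenberg R =
    \<lparr>carrier = carrier R \<times> carrier R \<times> carrier R,
     monoid.mult = (\<lambda>(x, y, t) (x', y', t').
       (x \<oplus>\<^bsub>R\<^esub> x', y \<oplus>\<^bsub>R\<^esub> y',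
        (t \<oplus>\<^bsub>R\<^esub> t') \<oplus>\<^bsub>R\<^esub> ((x \<otimes>\<^bsub>R\<^esub> y') \<ominus>\<^bsub>R\<^esub> (y \<otimes>\<^bsub>R\<^esub> x')))),
     one = (\<zero>\<^bsub>R\<^esub>, \<zero>\<^bsub>R\<^esub>, \<zero>\<^bsub>R\<^esub>)\<rparr>"

definition hline :: "('a, 'b) ring_scheme \<Rightarrow> 'a \<times> 'a \<times> 'a \<Rightarrow> 'a \<times> 'a \<Rightarrow> ('a \<times> 'a \<times> 'a) set" where
  "hline R p = (\<lambda>(a, b).
    {p \<otimes>\<^bsub>heisenberg R\<^esub> (s \<otimes>\<^bsub>R\<^esub> a, s \<otimes>\<^bsub>R\<^esub> b, \<zero>\<^bsub>R\<^esub>) | s. s \<in> carrier R})"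

definition slopes :: "('a, 'b) ring_scheme \<Rightarrow> ('a \<times> 'a) set" where
  "slopes R = carrier R \<times> carrier R - {(\<zero>\<^bsub>R\<^esub>, \<zero>\<^bsub>R\<^esub>)}"

definition horizontal_lines :: "('a, 'b) ring_scheme \<Rightarrow> ('a \<times> 'a \<times> 'a) set set" where
  "horizontal_lines R = {hline R p d | p d. p \<in> carrier (heisenberg R) \<and> d \<in> slopes R}"

text \<open>The point \<open>[a : b : c]\<close> of the projective plane, as the class of nonzero multiples of \<open>(a, b, c)\<close>.\<close>

definition proj_point :: "('a, 'b) ring_scheme \<Rightarrow> 'a \<Rightarrow> 'a \<Rightarrow> 'a \<Rightarrow> ('a \<times> 'a \<times> 'a) set" where
  "proj_point R a b c =
    {(k \<otimes>\<^bsub>R\<^esub> a, k \<otimes>\<^bsub>R\<^esub> b, k \<otimes>\<^bsub>R\<^esub> c) | k. k \<in> carrier R - {\<zero>\<^bsub>R\<^esub>}}"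

definition refined_directions :: "('a, 'b) ring_scheme \<Rightarrow> ('a \<times> 'a \<times> 'a) set set" where
  "refined_directions R = {proj_point R a b c | a b c. (a, b) \<in> slopes R \<and> c \<in> carrier R}"

definition Dir :: "('a, 'b) ring_scheme \<Rightarrow> ('a \<times> 'a \<times> 'a) set \<Rightarrow> ('a \<times> 'a \<times> 'a) set" where
  "Dir R L = (THE \<omega>. \<exists>x y t a b.
     (x, y, t) \<in> carrier (heisenberg R) \<and> (a, b) \<in> slopes R \<and> L = hline R (x, y, t) (a, b) \<and>
     \<omega> = proj_point R a b ((x \<otimes>\<^bsub>R\<^esub> b) \<ominus>\<^bsub>R\<^esub> (y \<otimes>\<^bsub>R\<^esub> a)))"

text \<open>The direction does not depend on the base point and the slope chosen to represent the line.\<close>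

lemma Dir_hline:
  assumes "field R" and p: "(x, y, t) \<in> carrier (heisenberg R)" and d: "(a, b) \<in> slopes R"
  shows "Dir R (hline R (x, y, t) (a, b)) =
    proj_point R a b ((x \<otimes>\<^bsub>R\<^esub> b) \<ominus>\<^bsub>R\<^esub> (y \<otimes>\<^bsub>R\<^esub> a))"
proof -
  interpret field R by fact
  have sub: "(u \<oplus>\<^bsub>R\<^esub> w) \<ominus>\<^bsub>R\<^esub> u = w" if "u \<in> carrier R" "w \<in> carrier R" for u w
    using that by algebra
  have diff: "(u \<oplus>\<^bsub>R\<^esub> r \<otimes>\<^bsub>R\<^esub> w) \<ominus>\<^bsub>R\<^esub> (u \<oplus>\<^bsub>R\<^esub> s \<otimes>\<^bsub>R\<^esub> w) = (r \<ominus>\<^bsub>R\<^esub> s) \<otimes>\<^bsub>R\<^esub> w"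
    if "u \<in> carrier R" "w \<in> carrier R" "r \<in> carrier R" "s \<in> carrier R" for u w r s
    using that by algebra
  have twist: "(u \<oplus>\<^bsub>R\<^esub> s \<otimes>\<^bsub>R\<^esub> v) \<otimes>\<^bsub>R\<^esub> (k \<otimes>\<^bsub>R\<^esub> w) \<ominus>\<^bsub>R\<^esub> (z \<oplus>\<^bsub>R\<^esub> s \<otimes>\<^bsub>R\<^esub> w) \<otimes>\<^bsub>R\<^esub> (k \<otimes>\<^bsub>R\<^esub> v) =
      k \<otimes>\<^bsub>R\<^esub> (u \<otimes>\<^bsub>R\<^esub> w \<ominus>\<^bsub>R\<^esub> z \<otimes>\<^bsub>R\<^esub> v)"
    if "u \<in> carrier R" "z \<in> carrier R" "v \<in> carrier R" "w \<in> carrier R" "k \<in> carrier R" "s \<in> carrier R"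
    for u z v w k s
    using that by algebra
  have pt: "\<exists>s\<in>carrier R. u = x' \<oplus>\<^bsub>R\<^esub> s \<otimes>\<^bsub>R\<^esub> a' \<and> w = y' \<oplus>\<^bsub>R\<^esub> s \<otimes>\<^bsub>R\<^esub> b'"
    if "(u, w, z) \<in> hline R (x', y', t') (a', b')" for u w z x' y' t' a' b'
    using that by (auto simp: hline_def heisenberg_def)
  have mem: "\<exists>z. (x \<oplus>\<^bsub>R\<^esub> s \<otimes>\<^bsub>R\<^esub> a, y \<oplus>\<^bsub>R\<^esub> s \<otimes>\<^bsub>R\<^esub> b, z) \<in> hline R (x, y, t) (a, b)"
    if "s \<in> carrier R" for s
    using that by (auto simp: hline_def heisenberg_def)
  have c: "x \<in> carrier R" "y \<in> carrier R" "a \<in> carrier R" "b \<in> carrier R"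
    using p d by (auto simp: heisenberg_def slopes_def)
  have uniq: "proj_point R a' b' ((x' \<otimes>\<^bsub>R\<^esub> b') \<ominus>\<^bsub>R\<^esub> (y' \<otimes>\<^bsub>R\<^esub> a')) =
      proj_point R a b ((x \<otimes>\<^bsub>R\<^esub> b) \<ominus>\<^bsub>R\<^esub> (y \<otimes>\<^bsub>R\<^esub> a))"
    if p': "(x', y', t') \<in> carrier (heisenberg R)" and d': "(a', b') \<in> slopes R"
      and L: "hline R (x, y, t) (a, b) = hline R (x', y', t') (a', b')" for x' y' t' a' b'
  proof -
    have c': "x' \<in> carrier R" "y' \<in> carrier R" "a' \<in> carrier R" "b' \<in> carrier R"
      using p' d' by (auto simp: heisenberg_def slopes_def)
    obtain s where s: "s \<in> carrier R" "x = x' \<oplus>\<^bsub>R\<^esub> s \<otimes>\<^bsub>R\<^esub> a'" "y = y' \<oplus>\<^bsub>R\<^esub> s \<otimes>\<^bsub>R\<^esub> b'"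
      using mem[of "\<zero>\<^bsub>R\<^esub>", unfolded L] c by (auto dest!: pt)
    obtain r where r: "r \<in> carrier R" "x \<oplus>\<^bsub>R\<^esub> a = x' \<oplus>\<^bsub>R\<^esub> r \<otimes>\<^bsub>R\<^esub> a'" "y \<oplus>\<^bsub>R\<^esub> b = y' \<oplus>\<^bsub>R\<^esub> r \<otimes>\<^bsub>R\<^esub> b'"
      using mem[of "\<one>\<^bsub>R\<^esub>", unfolded L] c by (auto dest!: pt)
    define k where "k = r \<ominus>\<^bsub>R\<^esub> s"
    have k: "k \<in> carrier R" using r s by (simp add: k_def)
    have a: "a = k \<otimes>\<^bsub>R\<^esub> a'"
      using sub[of x a] diff[of x' a' r s] c c' r s(1) by (simp add: k_def flip: s(2))
    have b: "b = k \<otimes>\<^bsub>R\<^esub> b'"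
      using sub[of y b] diff[of y' b' r s] c c' r s(1) by (simp add: k_def flip: s(3))
    have "k \<noteq> \<zero>\<^bsub>R\<^esub>" using a b d c' by (auto simp: slopes_def)
    then have k0: "k \<in> carrier R - {\<zero>\<^bsub>R\<^esub>}" using k by simp
    define e' where "e' = (x' \<otimes>\<^bsub>R\<^esub> b') \<ominus>\<^bsub>R\<^esub> (y' \<otimes>\<^bsub>R\<^esub> a')"
    have e': "e' \<in> carrier R" using c' by (simp add: e'_def)
    have e: "(x \<otimes>\<^bsub>R\<^esub> b) \<ominus>\<^bsub>R\<^esub> (y \<otimes>\<^bsub>R\<^esub> a) = k \<otimes>\<^bsub>R\<^esub> e'"
      unfolding s(2,3) a b e'_def using twist c' k s(1) by blast
    have "proj_point R (k \<otimes>\<^bsub>R\<^esub> a') (k \<otimes>\<^bsub>R\<^esub> b') (k \<otimes>\<^bsub>R\<^esub> e') = proj_point R a' b' e'"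
    proof (intro equalityI subsetI)
      fix z assume "z \<in> proj_point R (k \<otimes>\<^bsub>R\<^esub> a') (k \<otimes>\<^bsub>R\<^esub> b') (k \<otimes>\<^bsub>R\<^esub> e')"
      then obtain l where l: "l \<in> carrier R - {\<zero>\<^bsub>R\<^esub>}"
        "z = (l \<otimes>\<^bsub>R\<^esub> (k \<otimes>\<^bsub>R\<^esub> a'), l \<otimes>\<^bsub>R\<^esub> (k \<otimes>\<^bsub>R\<^esub> b'), l \<otimes>\<^bsub>R\<^esub> (k \<otimes>\<^bsub>R\<^esub> e'))"
        by (auto simp: proj_point_def)
      then have "l \<otimes>\<^bsub>R\<^esub> k \<in> carrier R - {\<zero>\<^bsub>R\<^esub>}" using k0 integral by auto
      moreover have "z = (l \<otimes>\<^bsub>R\<^esub> k \<otimes>\<^bsub>R\<^esub> a', l \<otimes>\<^bsub>R\<^esub> k \<otimes>\<^bsub>R\<^esub> b', l \<otimes>\<^bsub>R\<^esub> k \<otimes>\<^bsub>R\<^esub> e')"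
        using l k c' e' by (simp add: m_assoc)
      ultimately show "z \<in> proj_point R a' b' e'" unfolding proj_point_def by blast
    next
      fix z assume "z \<in> proj_point R a' b' e'"
      then obtain l where l: "l \<in> carrier R - {\<zero>\<^bsub>R\<^esub>}"
        "z = (l \<otimes>\<^bsub>R\<^esub> a', l \<otimes>\<^bsub>R\<^esub> b', l \<otimes>\<^bsub>R\<^esub> e')"
        by (auto simp: proj_point_def)
      have kU: "k \<in> Units R" using k0 field_Units by simp
      have inv0: "inv\<^bsub>R\<^esub> k \<in> carrier R - {\<zero>\<^bsub>R\<^esub>}" using kU field_Units Units_inv_Units by blast
      define m where "m = l \<otimes>\<^bsub>R\<^esub> inv\<^bsub>R\<^esub> k"
      have m: "m \<in> carrier R - {\<zero>\<^bsub>R\<^esub>}" using l inv0 integral by (auto simp: m_def)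
      have mk: "m \<otimes>\<^bsub>R\<^esub> k = l" using l k inv0 kU by (simp add: m_def m_assoc)
      have "z = (m \<otimes>\<^bsub>R\<^esub> (k \<otimes>\<^bsub>R\<^esub> a'), m \<otimes>\<^bsub>R\<^esub> (k \<otimes>\<^bsub>R\<^esub> b'), m \<otimes>\<^bsub>R\<^esub> (k \<otimes>\<^bsub>R\<^esub> e'))"
        using l m k c' e' by (simp add: m_assoc[symmetric] mk)
      then show "z \<in> proj_point R (k \<otimes>\<^bsub>R\<^esub> a') (k \<otimes>\<^bsub>R\<^esub> b') (k \<otimes>\<^bsub>R\<^esub> e')"
        unfolding proj_point_def using m by blast
    qed
    then show ?thesis unfolding e unfolding a b e'_def by simp
  qed
  show ?thesis unfolding Dir_def
    by (rule the_equality) (use p d uniq in blast)+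
qed

definition full_direction_Kakeya :: "('a, 'b) ring_scheme \<Rightarrow> ('a \<times> 'a \<times> 'a) set \<Rightarrow> bool" where
  "full_direction_Kakeya R E \<longleftrightarrow> E \<subseteq> carrier (heisenberg R) \<and>
    (\<forall>\<omega>\<in>refined_directions R. \<exists>L\<in>horizontal_lines R. L \<subseteq> E \<and> Dir R L = \<omega>)"

definition maximal_rd ::
  "('a, 'b) ring_scheme \<Rightarrow> ('a \<times> 'a \<times> 'a \<Rightarrow> complex) \<Rightarrow> ('a \<times> 'a \<times> 'a) set \<Rightarrow> real" where
  "maximal_rd R F \<omega> = Max {\<Sum>p\<in>L. cmod (F p) | L. L \<in> horizontal_lines R \<and> Dir R L = \<omega>}"

text \<open>The \<open>\<ell>\<^sup>p\<close>-norm for counting measure on a finite nonempty set, \<open>1 \<le> p \<le> \<infinity>\<close>.\<close>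

definition lp_norm :: "ennreal \<Rightarrow> 'c set \<Rightarrow> ('c \<Rightarrow> 'd::real_normed_vector) \<Rightarrow> real" where
  "lp_norm p X f =
    (if p = \<infinity> then Max ((\<lambda>x. norm (f x)) ` X)
     else (\<Sum>x\<in>X. norm (f x) powr enn2real p) powr (1 / enn2real p))"

definition maximal_estimate :: "ennreal \<Rightarrow> ennreal \<Rightarrow> real \<Rightarrow> bool" where
  "maximal_estimate u v A \<longleftrightarrow>
    (\<exists>C>0. \<forall>R :: nat ring. odd_finite_field R \<longrightarrow>
      (\<forall>F. lp_norm v (refined_directions R) (maximal_rd R F)
         \<le> C * real (order R) powr A * lp_norm u (carrier (heisenberg R)) F))"

text \<open>
  The smallest admissible exponent: \<open>LEAST\<close> and not \<open>Inf\<close>, so the constant \<open>C\<close> is available at the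
  exponent itself once a least one is known to exist.
\<close>

definition A_rd :: "ennreal \<Rightarrow> ennreal \<Rightarrow> real" where
  "A_rd u v = (LEAST A. 0 \<le> A \<and> maximal_estimate u v A)"

end

theory Submission
  imports Defs "HOL-Analysis.Convex" "HOL-Number_Theory.Residues" "HOL-Algebra.Weak_Morphisms"
begin

text \<open>
  Above each direction \<open>[1 : b : -c]\<close> lie the lines \<open>{(s, s b + c, t - s c)}\<close>, and above \<open>[0 : 1 : c]\<close> the lines
  \<open>{(c, s, t + s c)}\<close>, with \<open>t\<close> arbitrary. Horizontal lines form (most of) a generalized quadrangle: the
  square of the collinearity operator \<open>B\<close> is \<open>q\<^sup>2 I\<close> plus \<open>q\<close> times the all-ones matrix, minus a positive
  operator, so \<open>B\<close> has norm at most \<open>q\<close> on functions of mean zero. Splitting off the mean gives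
  \<open>\<Sum>\<^sub>\<omega> (M F \<omega>)\<^sup>2 \<le> 7 q \<Sum> |F|\<^sup>2\<close>.

  The exponent \<open>A_rd u v\<close> is a \<open>LEAST\<close>, so it says nothing unless the infimum is attained; hence the
  sharp exponent is determined for all \<open>u\<close> and \<open>v\<close> without loss. Comparing line sums of \<open>|F|\<close> with
  line sums of \<open>|F| powr (u / 2)\<close> turns the \<open>\<ell>\<^sup>2\<close> bound into bounds at \<open>u = v\<close> and at \<open>1/u + 1/v = 1\<close>; the nesting of the
  \<open>\<ell>\<^sup>p\<close> norms gives the other pairs. Indicators of the whole group, a point and a line over the prime
  fields show that nothing better is possible. The incidence bound is the estimate applied to the
  indicator of \<open>E\<close>.
\<close>

subsection \<open>The collinearity operator\<close>

lemma sum_rotate: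
  "(\<Sum>i\<in>A. \<Sum>j\<in>B. \<Sum>k\<in>C. f i j k) = (\<Sum>j\<in>B. \<Sum>k\<in>C. \<Sum>i\<in>A. f i j k)"
  by (subst sum.swap) (intro sum.cong refl sum.swap)

locale finite_field = field R for R (structure) +
  assumes finite_carrier [simp, intro]: "finite (carrier R)"
begin

abbreviation K where "K \<equiv> carrier R"
abbreviation q :: real where "q \<equiv> real (order R)"

lemma card_K [simp]: "card K = order R" by (simp add: order_def)

lemma order_ge_2: "q \<ge> 2"
proof -
  have "card {\<zero>, \<one>} \<le> card K" by (intro card_mono) auto
  then show ?thesis by simp
qed

lemma sum_shift:
  assumes "a \<in> K" shows "(\<Sum>c\<in>K. f (c \<oplus> a)) = sum f K"
  by (rule sum.reindex_bij_witness[where i = "\<lambda>c. c \<ominus> a" and j = "\<lambda>c. c \<oplus> a"])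
     (use assms in \<open>auto, algebra+\<close>)

lemma inj_on_affine:
  assumes "k \<in> K" "k \<noteq> \<zero>" "a \<in> K"
  shows "inj_on (\<lambda>c. a \<oplus> c \<otimes> k) K"
proof (rule inj_onI)
  fix c c' assume "c \<in> K" "c' \<in> K" "a \<oplus> c \<otimes> k = a \<oplus> c' \<otimes> k"
  then show "c = c'" using assms by (simp add: m_rcancel)
qed

lemma image_affine:
  assumes "k \<in> K" "k \<noteq> \<zero>" "a \<in> K"
  shows "(\<lambda>c. a \<oplus> c \<otimes> k) ` K = K"
  using assms by (intro card_subset_eq card_image inj_on_affine) auto

lemma sum_affine:
  assumes "k \<in> K" "k \<noteq> \<zero>" "a \<in> K"
  shows "(\<Sum>c\<in>K. f (a \<oplus> c \<otimes> k)) = sum f K"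
  using sum.reindex[OF inj_on_affine[OF assms], of f] by (simp add: image_affine[OF assms] o_def)

text \<open>The standard symplectic form on the plane: the term that the Heisenberg law adds to the
  third coordinate.\<close>

definition twist :: "'a \<times> 'a \<Rightarrow> 'a \<times> 'a \<Rightarrow> 'a" where
  "twist p p' = fst p \<otimes> snd p' \<ominus> snd p \<otimes> fst p'"

lemma twist_closed [simp]: "p \<in> K \<times> K \<Longrightarrow> p' \<in> K \<times> K \<Longrightarrow> twist p p' \<in> K"
  by (auto simp: twist_def)

text \<open>
  Points \<open>(p, t)\<close> and \<open>(p', t')\<close> of the Heisenberg group with \<open>p \<noteq> p'\<close> lie on a common horizontal line iff
  \<open>t' = t \<oplus> twist p p'\<close>, so \<open>spread\<close> is the collinearity operator.
\<close>

definition spread :: "('a \<times> 'a \<Rightarrow> 'a \<Rightarrow> real) \<Rightarrow> 'a \<times> 'a \<Rightarrow> 'a \<Rightarrow> real" where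
  "spread F p' t = (\<Sum>p\<in>K \<times> K. F p (t \<ominus> twist p p'))"

text \<open>An off-diagonal block of the square of the collinearity operator. After shifting
  \<open>t\<close> by \<open>twist p1 p\<close>, the argument of \<open>g\<close> is
  \<open>t\<close> plus the form evaluated at \<open>p1 - p2\<close> and \<open>p\<close>. For
  \<open>p1 \<noteq> p2\<close> this is a nonzero linear functional of \<open>p\<close>, so it takes
  each value \<open>q\<close> times and the sum decouples.\<close>

lemma sum_twist:
  assumes "p1 \<in> K \<times> K" "p2 \<in> K \<times> K" "p1 \<noteq> p2"
  shows "(\<Sum>p\<in>K \<times> K. \<Sum>t\<in>K. f (t \<ominus> twist p1 p) * g (t \<ominus> twist p2 p)) =
    q * sum f K * (sum g K :: real)"
proof -
  obtain x1 y1 x2 y2 where p: "p1 = (x1, y1)" "p2 = (x2, y2)" by (cases p1, cases p2)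
  have c: "x1 \<in> K" "y1 \<in> K" "x2 \<in> K" "y2 \<in> K" using assms p by auto
  have 1: "(\<Sum>t\<in>K. f (t \<ominus> twist p1 (x, y)) * g (t \<ominus> twist p2 (x, y))) =
      (\<Sum>t\<in>K. f t * g (t \<oplus> (y2 \<ominus> y1) \<otimes> x \<oplus> y \<otimes> (x1 \<ominus> x2)))"
    if "x \<in> K" "y \<in> K" for x y
  proof -
    have e: "t \<oplus> (x1 \<otimes> y \<ominus> y1 \<otimes> x) \<ominus> (x1 \<otimes> y \<ominus> y1 \<otimes> x) = t"
      "t \<oplus> (x1 \<otimes> y \<ominus> y1 \<otimes> x) \<ominus> (x2 \<otimes> y \<ominus> y2 \<otimes> x) =
        t \<oplus> (y2 \<ominus> y1) \<otimes> x \<oplus> y \<otimes> (x1 \<ominus> x2)" if "t \<in> K" for t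
      using that c \<open>x \<in> K\<close> \<open>y \<in> K\<close> by algebra+
    have "(\<Sum>t\<in>K. f (t \<ominus> twist p1 (x, y)) * g (t \<ominus> twist p2 (x, y))) =
      (\<Sum>t\<in>K. f (t \<oplus> twist p1 (x, y) \<ominus> twist p1 (x, y)) * g (t \<oplus> twist p1 (x, y) \<ominus> twist p2 (x, y)))"
      by (rule sum_shift[symmetric]) (use c that p in auto)
    also have "\<dots> = (\<Sum>t\<in>K. f t * g (t \<oplus> (y2 \<ominus> y1) \<otimes> x \<oplus> y \<otimes> (x1 \<ominus> x2)))"
      by (rule sum.cong) (simp_all add: twist_def p e)
    finally show ?thesis .
  qed
  have "(\<Sum>p\<in>K \<times> K. \<Sum>t\<in>K. f (t \<ominus> twist p1 p) * g (t \<ominus> twist p2 p)) =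
      (\<Sum>x\<in>K. \<Sum>y\<in>K. \<Sum>t\<in>K. f t * g (t \<oplus> (y2 \<ominus> y1) \<otimes> x \<oplus> y \<otimes> (x1 \<ominus> x2)))" (is "_ = ?S")
    unfolding sum.cartesian_product' by (intro sum.cong refl 1)
  also have "?S = q * sum f K * sum g K"
  \<comment> \<open>Sum over whichever coordinate of \<open>p\<close> has a nonzero coefficient; the
    other coordinate contributes the factor \<open>q\<close>.\<close>
  proof (cases "x1 = x2")
    case False
    have d: "x1 \<ominus> x2 \<in> K" "x1 \<ominus> x2 \<noteq> \<zero>" using False c by auto
    have "?S = (\<Sum>x\<in>K. \<Sum>t\<in>K. f t * (\<Sum>y\<in>K. g (t \<oplus> (y2 \<ominus> y1) \<otimes> x \<oplus> y \<otimes> (x1 \<ominus> x2))))"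
      unfolding sum_distrib_left by (intro sum.cong refl sum.swap)
    also have "\<dots> = (\<Sum>x\<in>K. \<Sum>t\<in>K. f t * sum g K)"
      by (intro sum.cong refl arg_cong2[where f = "(*)"] sum_affine d) (use c in auto)
    finally show ?thesis by (simp add: sum_distrib_right)
  next
    case True
    then have d: "y2 \<ominus> y1 \<in> K" "y2 \<ominus> y1 \<noteq> \<zero>" using assms p c by auto
    have xx: "x1 \<ominus> x2 = \<zero>" using True c by simp
    have e: "t \<oplus> (y2 \<ominus> y1) \<otimes> x \<oplus> y \<otimes> (x1 \<ominus> x2) = t \<oplus> x \<otimes> (y2 \<ominus> y1)"
      if "t \<in> K" "x \<in> K" "y \<in> K" for t x y
      unfolding xx using that c by (simp add: m_comm)
    have "?S = (\<Sum>x\<in>K. \<Sum>y\<in>K. \<Sum>t\<in>K. f t * g (t \<oplus> x \<otimes> (y2 \<ominus> y1)))"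
      by (intro sum.cong refl) (simp add: e)
    also have "\<dots> = (\<Sum>y\<in>K. \<Sum>t\<in>K. f t * (\<Sum>x\<in>K. g (t \<oplus> x \<otimes> (y2 \<ominus> y1))))"
      unfolding sum_distrib_left
      by (subst sum.swap) (intro sum.cong refl sum.swap)
    also have "\<dots> = (\<Sum>x\<in>K. \<Sum>t\<in>K. f t * sum g K)"
      by (intro sum.cong refl arg_cong2[where f = "(*)"] sum_affine d) (use c in auto)
    finally show ?thesis by (simp add: sum_distrib_right)
  qed
  finally show ?thesis .
qed

text \<open>Expanding the square gives a double sum over base points \<open>p1\<close>,
  \<open>p2\<close>. Distinct ones decouple by \<open>sum_twist\<close>; for equal ones the two
  shifts agree, so each of the \<open>q\<^sup>2\<close> points \<open>p\<close> returns the square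
  sum over the fibre.\<close>

lemma sum_sq_spread:
  "(\<Sum>p\<in>K \<times> K. \<Sum>t\<in>K. (spread F p t)\<^sup>2) \<le>
    q * (\<Sum>p\<in>K \<times> K. \<Sum>t\<in>K. F p t)\<^sup>2 + q\<^sup>2 * (\<Sum>p\<in>K \<times> K. \<Sum>t\<in>K. (F p t)\<^sup>2)"
proof -
  define S where "S p = (\<Sum>t\<in>K. F p t)" for p
  define J where "J p1 p2 = (\<Sum>p\<in>K \<times> K. \<Sum>t\<in>K. F p1 (t \<ominus> twist p1 p) * F p2 (t \<ominus> twist p2 p))" for p1 p2
  have J: "J p1 p2 \<le> q * S p1 * S p2 + (if p1 = p2 then q\<^sup>2 * (\<Sum>t\<in>K. (F p1 t)\<^sup>2) else 0)"
    if p: "p1 \<in> K \<times> K" "p2 \<in> K \<times> K" for p1 p2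
  proof (cases "p1 = p2")
    case True
    have sh: "(\<Sum>t\<in>K. F p1 (t \<ominus> twist p1 r) * F p1 (t \<ominus> twist p1 r)) = (\<Sum>t\<in>K. (F p1 t)\<^sup>2)"
      if "r \<in> K \<times> K" for r
      using sum_shift[of "\<ominus> twist p1 r" "\<lambda>t. F p1 t * F p1 t"] p that
      by (simp add: power2_eq_square minus_eq)
    have "J p1 p2 = (\<Sum>r\<in>K \<times> K. \<Sum>t\<in>K. (F p1 t)\<^sup>2)"
      unfolding J_def True[symmetric] by (intro sum.cong refl sh)
    \<comment> \<open>The diagonal lacks the product term. It is a nonnegative square there, and
      adding it completes the double sum to the square of the total mass.\<close>
    moreover have "0 \<le> q * S p2 * S p2" by (simp add: mult.assoc)
    ultimately show ?thesis using True by (simp add: power2_eq_square card_cartesian_product)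
  next
    case False
    then show ?thesis using sum_twist[OF p False, of "F p1" "F p2"] by (simp add: J_def S_def)
  qed
  have "(\<Sum>p\<in>K \<times> K. \<Sum>t\<in>K. (spread F p t)\<^sup>2) =
      (\<Sum>p\<in>K \<times> K. \<Sum>t\<in>K. \<Sum>p1\<in>K \<times> K. \<Sum>p2\<in>K \<times> K. F p1 (t \<ominus> twist p1 p) * F p2 (t \<ominus> twist p2 p))"
    by (simp add: spread_def power2_eq_square sum_product)
  also have "\<dots> = (\<Sum>p\<in>K \<times> K. \<Sum>p1\<in>K \<times> K. \<Sum>p2\<in>K \<times> K. \<Sum>t\<in>K. F p1 (t \<ominus> twist p1 p) * F p2 (t \<ominus> twist p2 p))"
    by (rule sum.cong[OF refl], rule sum_rotate)
  also have "\<dots> = (\<Sum>p1\<in>K \<times> K. \<Sum>p2\<in>K \<times> K. J p1 p2)"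
    unfolding J_def by (rule sum_rotate)
  also have "\<dots> \<le> (\<Sum>p1\<in>K \<times> K. \<Sum>p2\<in>K \<times> K.
      q * S p1 * S p2 + (if p1 = p2 then q\<^sup>2 * (\<Sum>t\<in>K. (F p1 t)\<^sup>2) else 0))"
    by (intro sum_mono J)
  also have "\<dots> = (\<Sum>p1\<in>K \<times> K. \<Sum>p2\<in>K \<times> K. q * S p1 * S p2) +
      (\<Sum>p1\<in>K \<times> K. \<Sum>p2\<in>K \<times> K. if p1 = p2 then q\<^sup>2 * (\<Sum>t\<in>K. (F p1 t)\<^sup>2) else 0)"
    by (simp only: sum.distrib)
  also have "(\<Sum>p1\<in>K \<times> K. \<Sum>p2\<in>K \<times> K. q * S p1 * S p2) = q * (sum S (K \<times> K))\<^sup>2"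
    unfolding power2_eq_square sum_product unfolding sum_distrib_left mult.assoc by (rule refl)
  also have "(\<Sum>p1\<in>K \<times> K. \<Sum>p2\<in>K \<times> K. if p1 = p2 then q\<^sup>2 * (\<Sum>t\<in>K. (F p1 t)\<^sup>2) else 0) =
      q\<^sup>2 * (\<Sum>p\<in>K \<times> K. \<Sum>t\<in>K. (F p t)\<^sup>2)"
    by (simp add: sum_distrib_left)
  finally show ?thesis by (simp add: S_def)
qed

lemma inner_spread_le:
  assumes "(\<Sum>p\<in>K \<times> K. \<Sum>t\<in>K. F p t) = 0"
  shows "(\<Sum>p\<in>K \<times> K. \<Sum>t\<in>K. F p t * spread F p t) \<le> q * (\<Sum>p\<in>K \<times> K. \<Sum>t\<in>K. (F p t)\<^sup>2)"
proof -
  have q: "q > 0" using order_ge_2 by simp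
  \<comment> \<open>Cauchy-Schwarz in linear form. The weights balance the two terms because, on
    mean zero functions, \<open>spread\<close> multiplies the norm by at most
    \<open>q\<close>.\<close>
  have am: "x * y \<le> (q / 2) * x\<^sup>2 + (1 / (2 * q)) * y\<^sup>2" for x y :: real
  proof -
    have "0 \<le> (q * x - y)\<^sup>2 / (2 * q)" using q by simp
    also have "\<dots> = (q / 2) * x\<^sup>2 + (1 / (2 * q)) * y\<^sup>2 - x * y"
      using q by (simp add: field_simps power2_eq_square)
    finally show ?thesis by simp
  qed
  have "(\<Sum>p\<in>K \<times> K. \<Sum>t\<in>K. F p t * spread F p t) \<le>
      (\<Sum>p\<in>K \<times> K. \<Sum>t\<in>K. (q / 2) * (F p t)\<^sup>2 + (1 / (2 * q)) * (spread F p t)\<^sup>2)"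
    by (intro sum_mono am)
  also have "\<dots> = (q / 2) * (\<Sum>p\<in>K \<times> K. \<Sum>t\<in>K. (F p t)\<^sup>2) +
      (1 / (2 * q)) * (\<Sum>p\<in>K \<times> K. \<Sum>t\<in>K. (spread F p t)\<^sup>2)"
    by (simp only: sum.distrib sum_distrib_left)
  also have "\<dots> \<le> (q / 2) * (\<Sum>p\<in>K \<times> K. \<Sum>t\<in>K. (F p t)\<^sup>2) +
      (1 / (2 * q)) * (q\<^sup>2 * (\<Sum>p\<in>K \<times> K. \<Sum>t\<in>K. (F p t)\<^sup>2))"
    using sum_sq_spread[of F] assms q by (intro add_left_mono mult_left_mono) auto
  also have "\<dots> = q * (\<Sum>p\<in>K \<times> K. \<Sum>t\<in>K. (F p t)\<^sup>2)"
    using q by (simp add: field_simps power2_eq_square)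
  finally show ?thesis .
qed

text \<open>Two points over distinct abscissae \<open>s\<close>, \<open>s'\<close> lie on at most
  one slope line. Hence lines \<open>(b, c, t)\<close> correspond to triples
  \<open>(y, y', t)\<close>, and the heights on the line differ by \<open>(s - s') c\<close>, which
  is exactly the twist of the two points.\<close>

lemma sum_line_pair:
  assumes "s \<in> K" "s' \<in> K" "s \<noteq> s'"
  shows "(\<Sum>b\<in>K. \<Sum>c\<in>K. \<Sum>t\<in>K.
      F (s, s \<otimes> b \<oplus> c) (t \<ominus> s \<otimes> c) * G (s', s' \<otimes> b \<oplus> c) (t \<ominus> s' \<otimes> c)) =
    (\<Sum>y\<in>K. \<Sum>y'\<in>K. \<Sum>t\<in>K. F (s, y) t * (G (s', y') (t \<oplus> twist (s, y) (s', y')) :: real))"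
proof -
  have d: "s' \<ominus> s \<in> K" "s' \<ominus> s \<noteq> \<zero>" using assms by auto
  have 1: "(\<Sum>t\<in>K. F (s, s \<otimes> b \<oplus> c) (t \<ominus> s \<otimes> c) * G (s', s' \<otimes> b \<oplus> c) (t \<ominus> s' \<otimes> c)) =
      (\<Sum>t\<in>K. F (s, s \<otimes> b \<oplus> c) t * G (s', s' \<otimes> b \<oplus> c) (t \<oplus> (s \<ominus> s') \<otimes> c))"
    if "b \<in> K" "c \<in> K" for b c
  proof -
    have e: "t \<oplus> s \<otimes> c \<ominus> s \<otimes> c = t" "t \<oplus> s \<otimes> c \<ominus> s' \<otimes> c = t \<oplus> (s \<ominus> s') \<otimes> c" if "t \<in> K" for t
      using that assms \<open>c \<in> K\<close> by algebra+
    have "(\<Sum>t\<in>K. F (s, s \<otimes> b \<oplus> c) (t \<ominus> s \<otimes> c) * G (s', s' \<otimes> b \<oplus> c) (t \<ominus> s' \<otimes> c)) =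
      (\<Sum>t\<in>K. F (s, s \<otimes> b \<oplus> c) (t \<oplus> s \<otimes> c \<ominus> s \<otimes> c) * G (s', s' \<otimes> b \<oplus> c) (t \<oplus> s \<otimes> c \<ominus> s' \<otimes> c))"
      by (rule sum_shift[symmetric]) (use assms that in auto)
    then show ?thesis by (simp add: e cong: sum.cong)
  qed
  \<comment> \<open>For fixed \<open>b\<close>, substitute \<open>y = s b + c\<close>. The second
    ordinate is then \<open>y + b (s' - s)\<close>, which runs over the whole field as
    \<open>b\<close> does.\<close>
  have 2: "(\<Sum>c\<in>K. \<Sum>t\<in>K. F (s, s \<otimes> b \<oplus> c) t * G (s', s' \<otimes> b \<oplus> c) (t \<oplus> (s \<ominus> s') \<otimes> c)) =
      (\<Sum>y\<in>K. \<Sum>t\<in>K. F (s, y) t * G (s', y \<oplus> b \<otimes> (s' \<ominus> s)) (t \<oplus> twist (s, y) (s', y \<oplus> b \<otimes> (s' \<ominus> s))))"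
    if "b \<in> K" for b
  proof -
    have e: "s \<otimes> b \<oplus> (y \<oplus> \<ominus> (s \<otimes> b)) = y"
      "s' \<otimes> b \<oplus> (y \<oplus> \<ominus> (s \<otimes> b)) = y \<oplus> b \<otimes> (s' \<ominus> s)"
      "(s \<ominus> s') \<otimes> (y \<oplus> \<ominus> (s \<otimes> b)) = s \<otimes> (y \<oplus> b \<otimes> (s' \<ominus> s)) \<ominus> y \<otimes> s'" if "y \<in> K" for y
      using that assms(1,2) \<open>b \<in> K\<close> by algebra+
    show ?thesis
      by (subst sum_shift[symmetric, of "\<ominus> (s \<otimes> b)"])
        (use assms that in \<open>simp_all add: e twist_def cong: sum.cong\<close>)
  qed
  have "(\<Sum>b\<in>K. \<Sum>c\<in>K. \<Sum>t\<in>K.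
      F (s, s \<otimes> b \<oplus> c) (t \<ominus> s \<otimes> c) * G (s', s' \<otimes> b \<oplus> c) (t \<ominus> s' \<otimes> c)) =
    (\<Sum>b\<in>K. \<Sum>c\<in>K. \<Sum>t\<in>K. F (s, s \<otimes> b \<oplus> c) t * G (s', s' \<otimes> b \<oplus> c) (t \<oplus> (s \<ominus> s') \<otimes> c))"
    by (intro sum.cong refl 1)
  also have "\<dots> = (\<Sum>b\<in>K. \<Sum>y\<in>K. \<Sum>t\<in>K. F (s, y) t * G (s', y \<oplus> b \<otimes> (s' \<ominus> s))
      (t \<oplus> twist (s, y) (s', y \<oplus> b \<otimes> (s' \<ominus> s))))"
    by (intro sum.cong refl 2)
  also have "\<dots> = (\<Sum>y\<in>K. \<Sum>b\<in>K. \<Sum>t\<in>K. F (s, y) t * G (s', y \<oplus> b \<otimes> (s' \<ominus> s))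
      (t \<oplus> twist (s, y) (s', y \<oplus> b \<otimes> (s' \<ominus> s))))"
    by (rule sum.swap)
  also have "\<dots> = (\<Sum>y\<in>K. \<Sum>y'\<in>K. \<Sum>t\<in>K. F (s, y) t * G (s', y') (t \<oplus> twist (s, y) (s', y')))"
    by (intro sum.cong refl sum_affine d)
  finally show ?thesis .
qed

lemma twist_swap:
  assumes "p \<in> K \<times> K" "p' \<in> K \<times> K" shows "\<ominus> twist p p' = twist p' p"
proof -
  have "\<ominus> (x \<otimes> y' \<ominus> y \<otimes> x') = x' \<otimes> y \<ominus> y' \<otimes> x" if "x \<in> K" "y \<in> K" "x' \<in> K" "y' \<in> K" for x y x' y'
    using that by algebra
  then show ?thesis using assms by (auto simp: twist_def)
qed

text \<open>Expand the square over pairs of abscissae. Each point lies on \<open>q\<close> slope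
  lines, which accounts for equal abscissae; distinct abscissae give all collinear pairs outside a
  common plane \<open>x = s\<close>. The pairs inside such a plane, which \<open>spread\<close> also
  counts, have nonnegative total and can be added.\<close>

lemma line_energy_le:
  "(\<Sum>b\<in>K. \<Sum>c\<in>K. \<Sum>t\<in>K. (\<Sum>s\<in>K. F (s, s \<otimes> b \<oplus> c) (t \<ominus> s \<otimes> c))\<^sup>2) \<le>
    q * (\<Sum>p\<in>K \<times> K. \<Sum>t\<in>K. (F p t)\<^sup>2) + (\<Sum>p\<in>K \<times> K. \<Sum>t\<in>K. F p t * spread F p t)"
proof -
  define D where "D s s' = (\<Sum>b\<in>K. \<Sum>c\<in>K. \<Sum>t\<in>K.
    F (s, s \<otimes> b \<oplus> c) (t \<ominus> s \<otimes> c) * F (s', s' \<otimes> b \<oplus> c) (t \<ominus> s' \<otimes> c))" for s s'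
  define G where "G s s' = (\<Sum>y\<in>K. \<Sum>y'\<in>K. \<Sum>t\<in>K. F (s, y) t * F (s', y') (t \<oplus> twist (s, y) (s', y')))" for s s'
  define N where "N s = (\<Sum>y\<in>K. \<Sum>t\<in>K. (F (s, y) t)\<^sup>2)" for s
  have D_diag: "D s s = q * N s" if "s \<in> K" for s
  proof -
    have "D s s = (\<Sum>b\<in>K. \<Sum>c\<in>K. \<Sum>t\<in>K. (F (s, s \<otimes> b \<oplus> c) (t \<oplus> \<ominus> (s \<otimes> c)))\<^sup>2)"
      by (simp add: D_def power2_eq_square minus_eq)
    also have "\<dots> = (\<Sum>b\<in>K. \<Sum>c\<in>K. \<Sum>t\<in>K. (F (s, s \<otimes> b \<oplus> c) t)\<^sup>2)"
      by (intro sum.cong refl sum_shift) (use that in auto)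
    also have "\<dots> = (\<Sum>b\<in>K. \<Sum>c\<in>K. \<Sum>t\<in>K. (F (s, c \<oplus> s \<otimes> b) t)\<^sup>2)"
      using that by (intro sum.cong refl) (simp add: a_comm)
    also have "\<dots> = (\<Sum>b\<in>K. N s)"
      unfolding N_def by (intro sum.cong refl sum_shift) (use that in auto)
    finally show ?thesis by simp
  qed
  \<comment> \<open>Shifting \<open>t\<close> by \<open>s y\<close> turns the pair sum over the
    plane \<open>x = s\<close> into a sum of squares of vertical line sums.\<close>
  have G_diag: "0 \<le> G s s" if s: "s \<in> K" for s
  proof -
    have sh: "(\<Sum>t\<in>K. F (s, y) t * F (s, y') (t \<oplus> twist (s, y) (s, y'))) =
        (\<Sum>t\<in>K. F (s, y) (t \<oplus> s \<otimes> y) * F (s, y') (t \<oplus> s \<otimes> y'))" if "y \<in> K" "y' \<in> K" for y y'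
    proof -
      have "t \<oplus> s \<otimes> y \<oplus> (s \<otimes> y' \<ominus> y \<otimes> s) = t \<oplus> s \<otimes> y'" if "t \<in> K" for t
        using that s \<open>y \<in> K\<close> \<open>y' \<in> K\<close> by algebra
      then show ?thesis
        using s that
        by (subst sum_shift[symmetric, of "s \<otimes> y"]) (simp_all add: twist_def cong: sum.cong)
    qed
    have "G s s = (\<Sum>y\<in>K. \<Sum>y'\<in>K. \<Sum>t\<in>K. F (s, y) (t \<oplus> s \<otimes> y) * F (s, y') (t \<oplus> s \<otimes> y'))"
      unfolding G_def by (intro sum.cong refl sh)
    also have "\<dots> = (\<Sum>y\<in>K. \<Sum>t\<in>K. \<Sum>y'\<in>K. F (s, y) (t \<oplus> s \<otimes> y) * F (s, y') (t \<oplus> s \<otimes> y'))"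
      by (intro sum.cong refl sum.swap)
    also have "\<dots> = (\<Sum>t\<in>K. (\<Sum>y\<in>K. F (s, y) (t \<oplus> s \<otimes> y))\<^sup>2)"
      by (subst sum.swap) (simp add: power2_eq_square sum_product)
    finally show ?thesis by (simp add: sum_nonneg)
  qed
  have DG: "D s s' \<le> G s s' + (if s = s' then q * N s else 0)" if "s \<in> K" "s' \<in> K" for s s'
    using D_diag[of s] G_diag[of s] sum_line_pair[of s s' F F] that by (auto simp: D_def G_def)
  have "(\<Sum>b\<in>K. \<Sum>c\<in>K. \<Sum>t\<in>K. (\<Sum>s\<in>K. F (s, s \<otimes> b \<oplus> c) (t \<ominus> s \<otimes> c))\<^sup>2) =
    (\<Sum>b\<in>K. \<Sum>c\<in>K. \<Sum>t\<in>K. \<Sum>s\<in>K. \<Sum>s'\<in>K.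
      F (s, s \<otimes> b \<oplus> c) (t \<ominus> s \<otimes> c) * F (s', s' \<otimes> b \<oplus> c) (t \<ominus> s' \<otimes> c))"
    by (simp add: power2_eq_square sum_product)
  also have "\<dots> = (\<Sum>b\<in>K. \<Sum>c\<in>K. \<Sum>s\<in>K. \<Sum>s'\<in>K. \<Sum>t\<in>K.
      F (s, s \<otimes> b \<oplus> c) (t \<ominus> s \<otimes> c) * F (s', s' \<otimes> b \<oplus> c) (t \<ominus> s' \<otimes> c))"
    by (rule sum.cong[OF refl], rule sum.cong[OF refl], rule sum_rotate)
  also have "\<dots> = (\<Sum>b\<in>K. \<Sum>s\<in>K. \<Sum>s'\<in>K. \<Sum>c\<in>K. \<Sum>t\<in>K.
      F (s, s \<otimes> b \<oplus> c) (t \<ominus> s \<otimes> c) * F (s', s' \<otimes> b \<oplus> c) (t \<ominus> s' \<otimes> c))"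
    by (rule sum.cong[OF refl], rule sum_rotate)
  also have "\<dots> = (\<Sum>s\<in>K. \<Sum>s'\<in>K. D s s')"
    unfolding D_def by (rule sum_rotate)
  also have "\<dots> \<le> (\<Sum>s\<in>K. \<Sum>s'\<in>K. G s s' + (if s = s' then q * N s else 0))"
    by (intro sum_mono DG)
  also have "\<dots> = (\<Sum>s\<in>K. \<Sum>s'\<in>K. G s s') + q * (\<Sum>p\<in>K \<times> K. \<Sum>t\<in>K. (F p t)\<^sup>2)"
    by (simp add: sum.distrib N_def sum.cartesian_product' flip: sum_distrib_left)
  also have "(\<Sum>s\<in>K. \<Sum>s'\<in>K. G s s') = (\<Sum>p\<in>K \<times> K. \<Sum>t\<in>K. F p t * spread F p t)"
  proof -
    have sp: "(\<Sum>t\<in>K. F p t * spread F p t) = (\<Sum>p'\<in>K \<times> K. \<Sum>t\<in>K. F p t * F p' (t \<oplus> twist p p'))"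
      if "p \<in> K \<times> K" for p
      using that unfolding spread_def sum_distrib_left
      by (subst sum.swap) (intro sum.cong refl, simp add: minus_eq twist_swap)
    have "(\<Sum>s\<in>K. \<Sum>s'\<in>K. G s s') = (\<Sum>s\<in>K. \<Sum>y\<in>K. \<Sum>s'\<in>K. \<Sum>y'\<in>K. \<Sum>t\<in>K.
        F (s, y) t * F (s', y') (t \<oplus> twist (s, y) (s', y')))"
      unfolding G_def by (intro sum.cong refl sum.swap)
    also have "\<dots> = (\<Sum>p\<in>K \<times> K. \<Sum>p'\<in>K \<times> K. \<Sum>t\<in>K. F p t * F p' (t \<oplus> twist p p'))"
      by (simp only: sum.cartesian_product')
    also have "\<dots> = (\<Sum>p\<in>K \<times> K. \<Sum>t\<in>K. F p t * spread F p t)"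
      by (intro sum.cong refl sp[symmetric])
    finally show ?thesis .
  qed
  finally show ?thesis by simp
qed

text \<open>The choice of one line per direction is arbitrary, so the mean zero part is bounded by
  the energy of all slope lines, at most \<open>2 q N\<close>, while the mean is treated on the
  chosen lines alone. Together with the factor 2 for splitting the square, the parts contribute 4
  and 2 to the constant.\<close>

lemma sum_sq_slope_lines:
  fixes F :: "'a \<times> 'a \<Rightarrow> 'a \<Rightarrow> real"
  assumes t: "\<And>b c. b \<in> K \<Longrightarrow> c \<in> K \<Longrightarrow> t b c \<in> K"
  shows "(\<Sum>b\<in>K. \<Sum>c\<in>K. (\<Sum>s\<in>K. F (s, s \<otimes> b \<oplus> c) (t b c \<ominus> s \<otimes> c))\<^sup>2) \<le>
    6 * q * (\<Sum>p\<in>K \<times> K. \<Sum>t\<in>K. (F p t)\<^sup>2)"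
proof -
  have q: "q > 0" using order_ge_2 by simp
  define T where "T = (\<Sum>p\<in>K \<times> K. \<Sum>t\<in>K. F p t)"
  define N where "N = (\<Sum>p\<in>K \<times> K. \<Sum>t\<in>K. (F p t)\<^sup>2)"
  define M where "M = T / q ^ 3"
  define F0 where "F0 p t = F p t - M" for p t
  have sum0: "(\<Sum>p\<in>K \<times> K. \<Sum>t\<in>K. F0 p t) = 0"
    using q by (simp add: F0_def sum_subtractf T_def[symmetric] M_def card_cartesian_product power3_eq_cube)
  have "(\<Sum>p\<in>K \<times> K. \<Sum>t\<in>K. (F0 p t)\<^sup>2) = N - 2 * M * T + q ^ 3 * M\<^sup>2"
    by (simp add: F0_def power2_diff sum.distrib sum_subtractf N_def[symmetric] T_def card_cartesian_product
        power3_eq_cube sum_distrib_left mult_ac)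
  also have "\<dots> = N - T\<^sup>2 / q ^ 3"
    using q by (simp add: M_def field_simps power2_eq_square power3_eq_cube)
  finally have N0: "(\<Sum>p\<in>K \<times> K. \<Sum>t\<in>K. (F0 p t)\<^sup>2) = N - T\<^sup>2 / q ^ 3" .
  \<comment> \<open>Nonnegativity of the variance is Cauchy-Schwarz for the total mass
    \<open>T\<close>.\<close>
  have "0 \<le> (\<Sum>p\<in>K \<times> K. \<Sum>t\<in>K. (F0 p t)\<^sup>2)" by (intro sum_nonneg) auto
  then have T_le: "T\<^sup>2 \<le> q ^ 3 * N" using N0 q by (simp add: field_simps)
  have N0_le: "(\<Sum>p\<in>K \<times> K. \<Sum>t\<in>K. (F0 p t)\<^sup>2) \<le> N" using N0 q by simp
  have energy: "(\<Sum>b\<in>K. \<Sum>c\<in>K. \<Sum>t\<in>K. (\<Sum>s\<in>K. F0 (s, s \<otimes> b \<oplus> c) (t \<ominus> s \<otimes> c))\<^sup>2) \<le> 2 * q * N"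
    using line_energy_le[of F0] inner_spread_le[OF sum0] mult_left_mono[OF N0_le, of q] q by linarith
  \<comment> \<open>Only the mean zero part is summed over all heights \<open>t\<close>; doing so
    for the constant part would cost a factor \<open>q\<close>.\<close>
  have pt: "(\<Sum>s\<in>K. F (s, s \<otimes> b \<oplus> c) (t b c \<ominus> s \<otimes> c))\<^sup>2 \<le>
      2 * (\<Sum>t\<in>K. (\<Sum>s\<in>K. F0 (s, s \<otimes> b \<oplus> c) (t \<ominus> s \<otimes> c))\<^sup>2) + 2 * (q * M)\<^sup>2"
    if "b \<in> K" "c \<in> K" for b c
  proof -
    define X where "X = (\<Sum>s\<in>K. F0 (s, s \<otimes> b \<oplus> c) (t b c \<ominus> s \<otimes> c))"
    have "(\<Sum>s\<in>K. F (s, s \<otimes> b \<oplus> c) (t b c \<ominus> s \<otimes> c)) = X + q * M"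
      by (simp add: X_def F0_def sum_subtractf)
    moreover have "(X + q * M)\<^sup>2 \<le> 2 * X\<^sup>2 + 2 * (q * M)\<^sup>2"
      using sum_squares_ge_zero[of "X - q * M" 0] by (simp add: power2_eq_square algebra_simps)
    moreover have "X\<^sup>2 \<le> (\<Sum>t\<in>K. (\<Sum>s\<in>K. F0 (s, s \<otimes> b \<oplus> c) (t \<ominus> s \<otimes> c))\<^sup>2)"
      unfolding X_def by (rule member_le_sum) (use t that in auto)
    ultimately show ?thesis by simp
  qed
  have "(\<Sum>b\<in>K. \<Sum>c\<in>K. (\<Sum>s\<in>K. F (s, s \<otimes> b \<oplus> c) (t b c \<ominus> s \<otimes> c))\<^sup>2) \<le>
      (\<Sum>b\<in>K. \<Sum>c\<in>K. 2 * (\<Sum>t\<in>K. (\<Sum>s\<in>K. F0 (s, s \<otimes> b \<oplus> c) (t \<ominus> s \<otimes> c))\<^sup>2) + 2 * (q * M)\<^sup>2)"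
    by (intro sum_mono pt)
  also have "\<dots> = 2 * (\<Sum>b\<in>K. \<Sum>c\<in>K. \<Sum>t\<in>K. (\<Sum>s\<in>K. F0 (s, s \<otimes> b \<oplus> c) (t \<ominus> s \<otimes> c))\<^sup>2) + 2 * q\<^sup>2 * (q * M)\<^sup>2"
    by (simp add: sum.distrib power2_eq_square flip: sum_distrib_left)
  also have "\<dots> \<le> 2 * (2 * q * N) + 2 * (q * N)"
  proof (intro add_mono mult_left_mono energy)
    have "2 * q\<^sup>2 * (q * M)\<^sup>2 = 2 * (T\<^sup>2 / q\<^sup>2)"
      using q by (simp add: M_def field_simps power2_eq_square power3_eq_cube)
    also have "\<dots> \<le> 2 * ((q ^ 3 * N) / q\<^sup>2)"
      by (intro mult_left_mono divide_right_mono T_le) auto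
    also have "\<dots> = 2 * (q * N)"
      using q by (simp add: field_simps power2_eq_square power3_eq_cube)
    finally show "2 * q\<^sup>2 * (q * M)\<^sup>2 \<le> 2 * (q * N)" .
  qed auto
  finally show ?thesis by (simp add: N_def)
qed

text \<open>The chosen lines lie in the disjoint planes \<open>x = c\<close>, so Cauchy-Schwarz on
  each line of \<open>q\<close> points is enough.\<close>

lemma sum_sq_vertical_lines:
  fixes F :: "'a \<times> 'a \<Rightarrow> 'a \<Rightarrow> real"
  assumes t: "\<And>c. c \<in> K \<Longrightarrow> t c \<in> K"
  shows "(\<Sum>c\<in>K. (\<Sum>s\<in>K. F (c, s) (t c \<oplus> s \<otimes> c))\<^sup>2) \<le> q * (\<Sum>p\<in>K \<times> K. \<Sum>t\<in>K. (F p t)\<^sup>2)"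
proof -
  have "(\<Sum>s\<in>K. F (c, s) (t c \<oplus> s \<otimes> c))\<^sup>2 \<le> q * (\<Sum>s\<in>K. \<Sum>t\<in>K. (F (c, s) t)\<^sup>2)" if "c \<in> K" for c
  proof -
    have "(\<Sum>s\<in>K. F (c, s) (t c \<oplus> s \<otimes> c))\<^sup>2 \<le> (\<Sum>s\<in>K. (F (c, s) (t c \<oplus> s \<otimes> c))\<^sup>2) * q"
      using sum_squared_le_sum_of_squares[of "\<lambda>s. F (c, s) (t c \<oplus> s \<otimes> c)" K] by simp
    also have "\<dots> \<le> (\<Sum>s\<in>K. \<Sum>t\<in>K. (F (c, s) t)\<^sup>2) * q"
    proof (intro mult_right_mono sum_mono)
      fix s assume "s \<in> K"
      then have "t c \<oplus> s \<otimes> c \<in> K" using that t by simp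
      then show "(F (c, s) (t c \<oplus> s \<otimes> c))\<^sup>2 \<le> (\<Sum>t\<in>K. (F (c, s) t)\<^sup>2)"
        by (intro member_le_sum[where f = "\<lambda>t. (F (c, s) t)\<^sup>2"]) auto
    qed auto
    finally show ?thesis by (simp add: mult.commute)
  qed
  then show ?thesis
    unfolding sum.cartesian_product' sum_distrib_left[of q _ K] by (rule sum_mono)
qed

subsection \<open>Horizontal lines and their directions\<close>

definition slope_line :: "'a \<Rightarrow> 'a \<Rightarrow> 'a \<Rightarrow> ('a \<times> 'a \<times> 'a) set" where
  "slope_line b c t = (\<lambda>s. (s, s \<otimes> b \<oplus> c, t \<ominus> s \<otimes> c)) ` K"

definition vertical_line :: "'a \<Rightarrow> 'a \<Rightarrow> ('a \<times> 'a \<times> 'a) set" where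
  "vertical_line c t = (\<lambda>s. (c, s, t \<oplus> s \<otimes> c)) ` K"

text \<open>The sign comes from the base point \<open>(0, c, t)\<close> and slope
  \<open>(1, b)\<close>: the third coordinate of the refined direction is
  \<open>0 b - c 1\<close>.\<close>

definition slope_dir :: "'a \<Rightarrow> 'a \<Rightarrow> ('a \<times> 'a \<times> 'a) set" where
  "slope_dir b c = proj_point R \<one> b (\<ominus> c)"

definition vertical_dir :: "'a \<Rightarrow> ('a \<times> 'a \<times> 'a) set" where
  "vertical_dir c = proj_point R \<zero> \<one> c"

lemma carrier_heisenberg [simp]: "carrier (heisenberg R) = K \<times> K \<times> K"
  by (simp add: heisenberg_def)

lemma hline_eq_image:
  "hline R (x, y, t) (a, b) =
    (\<lambda>s. (x \<oplus> s \<otimes> a, y \<oplus> s \<otimes> b, t \<oplus> \<zero> \<oplus> (x \<otimes> (s \<otimes> b) \<ominus> y \<otimes> (s \<otimes> a)))) ` K"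
  by (auto simp: hline_def heisenberg_def)

text \<open>Since \<open>a\<close> is invertible, the first coordinate \<open>x + s a\<close> runs
  over the field and can serve as the parameter.\<close>

lemma hline_slope_line:
  assumes "x \<in> K" "y \<in> K" "t \<in> K" "a \<in> K" "a \<noteq> \<zero>" "b \<in> K"
  defines "b' \<equiv> b \<otimes> inv a"
  shows "hline R (x, y, t) (a, b) = slope_line b' (y \<ominus> x \<otimes> b') (t \<oplus> x \<otimes> (y \<ominus> x \<otimes> b'))"
proof -
  have a: "a \<in> Units R" using assms field_Units by simp
  have b': "b' \<in> K" "b = b' \<otimes> a" using a assms by (auto simp: b'_def m_assoc)
  have e: "(x \<oplus> s \<otimes> a) \<otimes> b' \<oplus> (y \<ominus> x \<otimes> b') = y \<oplus> s \<otimes> (b' \<otimes> a)"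
    "t \<oplus> x \<otimes> (y \<ominus> x \<otimes> b') \<ominus> (x \<oplus> s \<otimes> a) \<otimes> (y \<ominus> x \<otimes> b') =
      t \<oplus> \<zero> \<oplus> (x \<otimes> (s \<otimes> (b' \<otimes> a)) \<ominus> y \<otimes> (s \<otimes> a))" if "s \<in> K" for s
    using that assms(1-4) b'(1) by algebra+
  have "slope_line b' (y \<ominus> x \<otimes> b') (t \<oplus> x \<otimes> (y \<ominus> x \<otimes> b')) =
    (\<lambda>s. (s, s \<otimes> b' \<oplus> (y \<ominus> x \<otimes> b'), t \<oplus> x \<otimes> (y \<ominus> x \<otimes> b') \<ominus> s \<otimes> (y \<ominus> x \<otimes> b'))) `
      (\<lambda>s. x \<oplus> s \<otimes> a) ` K"
    using assms(1-5) by (simp add: slope_line_def image_affine)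
  also have "\<dots> = hline R (x, y, t) (a, b)"
    unfolding hline_eq_image image_image by (intro image_cong refl) (simp add: e b'(2))
  finally show ?thesis by simp
qed

lemma hline_vertical_line:
  assumes "x \<in> K" "y \<in> K" "t \<in> K" "b \<in> K" "b \<noteq> \<zero>"
  shows "hline R (x, y, t) (\<zero>, b) = vertical_line x (t \<ominus> y \<otimes> x)"
proof -
  have e: "t \<ominus> y \<otimes> x \<oplus> (y \<oplus> s \<otimes> b) \<otimes> x = t \<oplus> \<zero> \<oplus> (x \<otimes> (s \<otimes> b) \<ominus> y \<otimes> (s \<otimes> \<zero>))"
    "x \<oplus> s \<otimes> \<zero> = x" if "s \<in> K" for s
    using that assms(1-4) by algebra+
  have "vertical_line x (t \<ominus> y \<otimes> x) =
    (\<lambda>s. (x, s, t \<ominus> y \<otimes> x \<oplus> s \<otimes> x)) ` (\<lambda>s. y \<oplus> s \<otimes> b) ` K"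
    using assms by (simp add: vertical_line_def image_affine)
  also have "\<dots> = hline R (x, y, t) (\<zero>, b)"
    unfolding hline_eq_image image_image by (intro image_cong refl) (simp only: e prod.inject)
  finally show ?thesis by simp
qed

lemma slope_line_hline:
  assumes "b \<in> K" "c \<in> K" "t \<in> K"
  shows "slope_line b c t = hline R (\<zero>, c, t) (\<one>, b)"
  using hline_slope_line[of \<zero> c t \<one> b] assms by (simp add: minus_eq)

lemma vertical_line_hline:
  assumes "c \<in> K" "t \<in> K"
  shows "vertical_line c t = hline R (c, \<zero>, t) (\<zero>, \<one>)"
  using hline_vertical_line[of c \<zero> t \<one>] assms by (simp add: minus_eq)

lemma hline_horizontal:
  "x \<in> K \<Longrightarrow> y \<in> K \<Longrightarrow> t \<in> K \<Longrightarrow> d \<in> slopes R \<Longrightarrow> hline R (x, y, t) d \<in> horizontal_lines R"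
  unfolding horizontal_lines_def
  by (rule CollectI, rule exI[of _ "(x, y, t)"], rule exI[of _ d]) simp

lemma slope_line_horizontal:
  assumes "b \<in> K" "c \<in> K" "t \<in> K" shows "slope_line b c t \<in> horizontal_lines R"
  unfolding slope_line_hline[OF assms] using assms by (intro hline_horizontal) (auto simp: slopes_def)

lemma vertical_line_horizontal:
  assumes "c \<in> K" "t \<in> K" shows "vertical_line c t \<in> horizontal_lines R"
  unfolding vertical_line_hline[OF assms] using assms by (intro hline_horizontal) (auto simp: slopes_def)

lemma Dir_slope_line:
  assumes "b \<in> K" "c \<in> K" "t \<in> K" shows "Dir R (slope_line b c t) = slope_dir b c"
  using Dir_hline[OF field_axioms, of \<zero> c t \<one> b] assms
  by (simp add: slope_line_hline slopes_def slope_dir_def minus_eq)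

lemma Dir_vertical_line:
  assumes "c \<in> K" "t \<in> K" shows "Dir R (vertical_line c t) = vertical_dir c"
  using Dir_hline[OF field_axioms, of c \<zero> t \<zero> \<one>] assms
  by (simp add: vertical_line_hline slopes_def vertical_dir_def minus_eq)

lemma horizontal_line_cases:
  assumes "L \<in> horizontal_lines R"
  obtains (slope) b c t where "b \<in> K" "c \<in> K" "t \<in> K" "L = slope_line b c t"
    | (vertical) c t where "c \<in> K" "t \<in> K" "L = vertical_line c t"
proof -
  obtain x y t a b where L: "L = hline R (x, y, t) (a, b)"
    and p: "x \<in> K" "y \<in> K" "t \<in> K" "a \<in> K" "b \<in> K" and ab: "(a, b) \<noteq> (\<zero>, \<zero>)"
    using assms by (fastforce simp: horizontal_lines_def slopes_def)
  show thesis
  proof (cases "a = \<zero>")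
    case True
    then show thesis
      using vertical[of x "t \<ominus> y \<otimes> x"] hline_vertical_line[of x y t b] L p ab by auto
  next
    case False
    then have "inv a \<in> K" using p field_Units by simp
    then show thesis
      using slope[OF _ _ _ L[unfolded hline_slope_line[OF p(1-4) False p(5)]]] p by simp
  qed
qed

lemma proj_point_scale:
  assumes "k \<in> K" "k \<noteq> \<zero>" "a \<in> K" "b \<in> K" "c \<in> K"
  shows "proj_point R (k \<otimes> a) (k \<otimes> b) (k \<otimes> c) = proj_point R a b c"
proof -
  have k: "k \<in> Units R" using assms field_Units by simp
  have "(\<lambda>l. l \<otimes> k) ` (K - {\<zero>}) = K - {\<zero>}"
    using k assms integral
    by (intro card_subset_eq card_image inj_onI) (auto simp: m_rcancel)
  moreover have "proj_point R (k \<otimes> a) (k \<otimes> b) (k \<otimes> c) =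
      (\<lambda>l. (l \<otimes> a, l \<otimes> b, l \<otimes> c)) ` (\<lambda>l. l \<otimes> k) ` (K - {\<zero>})"
    using assms by (auto simp: proj_point_def image_image m_assoc)
  ultimately show ?thesis by (auto simp: proj_point_def)
qed

text \<open>The normalised first coordinate 1 forces the scalar between two representatives to be
  1.\<close>

lemma slope_dir_inject:
  assumes "b \<in> K" "c \<in> K" "b' \<in> K" "c' \<in> K" "slope_dir b c = slope_dir b' c'"
  shows "b = b' \<and> c = c'"
proof -
  have "(\<one>, b, \<ominus> c) \<in> slope_dir b c"
    using assms(1,2) by (auto simp: slope_dir_def proj_point_def intro!: exI[of _ \<one>])
  then obtain k where "k \<in> K" "\<one> = k \<otimes> \<one>" "b = k \<otimes> b'" "\<ominus> c = k \<otimes> \<ominus> c'"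
    unfolding assms(5) by (auto simp: slope_dir_def proj_point_def)
  then have "b = b'" "\<ominus> c = \<ominus> c'" using assms by auto
  then show ?thesis using assms by (metis minus_minus)
qed

lemma vertical_dir_inject:
  assumes "c \<in> K" "c' \<in> K" "vertical_dir c = vertical_dir c'"
  shows "c = c'"
proof -
  have "(\<zero>, \<one>, c) \<in> vertical_dir c"
    using assms(1) by (auto simp: vertical_dir_def proj_point_def intro!: exI[of _ \<one>])
  then obtain k where "k \<in> K" "\<one> = k \<otimes> \<one>" "c = k \<otimes> c'"
    unfolding assms(3) by (auto simp: vertical_dir_def proj_point_def)
  then show ?thesis using assms by auto
qed

lemma slope_dir_neq_vertical_dir:
  assumes "b \<in> K" "c \<in> K" shows "slope_dir b c \<noteq> vertical_dir c'"
proof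
  assume eq: "slope_dir b c = vertical_dir c'"
  have "(\<one>, b, \<ominus> c) \<in> slope_dir b c"
    using assms by (auto simp: slope_dir_def proj_point_def intro!: exI[of _ \<one>])
  then show False unfolding eq by (auto simp: vertical_dir_def proj_point_def)
qed

lemma refined_directions_eq:
  "refined_directions R = (\<lambda>(b, c). slope_dir b c) ` (K \<times> K) \<union> vertical_dir ` K"
proof (intro equalityI subsetI)
  fix w assume "w \<in> refined_directions R"
  then obtain a b c where w: "w = proj_point R a b c" and p: "a \<in> K" "b \<in> K" "c \<in> K"
    and ab: "(a, b) \<noteq> (\<zero>, \<zero>)"
    by (auto simp: refined_directions_def slopes_def)
  show "w \<in> (\<lambda>(b, c). slope_dir b c) ` (K \<times> K) \<union> vertical_dir ` K"
  proof (cases "a = \<zero>")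
    case False
    then have a: "a \<in> Units R" using p field_Units by simp
    define b' c' where "b' = inv a \<otimes> b" "c' = \<ominus> (inv a \<otimes> c)"
    have p': "b' \<in> K" "c' \<in> K" using a p by (auto simp: b'_c'_def)
    have "a \<otimes> b' = b" "a \<otimes> \<ominus> c' = c" using a p by (auto simp: b'_c'_def simp flip: m_assoc)
    then have "w = slope_dir b' c'"
      using proj_point_scale[of a \<one> b' "\<ominus> c'"] p p' False by (simp add: w slope_dir_def)
    then show ?thesis using p' by auto
  next
    case True
    then have b: "b \<in> Units R" using p ab field_Units by simp
    have c': "inv b \<otimes> c \<in> K" using b p by auto
    have "b \<otimes> (inv b \<otimes> c) = c" using b p by (simp flip: m_assoc)
    then have "w = vertical_dir (inv b \<otimes> c)"
      using proj_point_scale[of b \<zero> \<one> "inv b \<otimes> c"] p c' True ab by (simp add: w vertical_dir_def)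
    then show ?thesis using c' by auto
  qed
next
  fix w assume "w \<in> (\<lambda>(b, c). slope_dir b c) ` (K \<times> K) \<union> vertical_dir ` K"
  then show "w \<in> refined_directions R"
    by (fastforce simp: refined_directions_def slopes_def slope_dir_def vertical_dir_def)
qed

text \<open>Once the direction is fixed, only the height \<open>t\<close> is free: the maximal
  function is a maximum over \<open>t\<close> in the field.\<close>

lemma Dir_eq_slope_dir_iff:
  assumes "b \<in> K" "c \<in> K"
  shows "L \<in> horizontal_lines R \<and> Dir R L = slope_dir b c \<longleftrightarrow> L \<in> slope_line b c ` K"
proof
  assume "L \<in> horizontal_lines R \<and> Dir R L = slope_dir b c"
  then have L: "L \<in> horizontal_lines R" and d: "Dir R L = slope_dir b c" by auto
  from L show "L \<in> slope_line b c ` K"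
  proof (cases rule: horizontal_line_cases)
    case (slope b' c' t)
    then show ?thesis using d assms slope_dir_inject[of b c b' c'] by (auto simp: Dir_slope_line)
  next
    case (vertical c' t)
    then show ?thesis
      using d assms slope_dir_neq_vertical_dir[of b c c'] by (auto simp: Dir_vertical_line)
  qed
qed (use assms in \<open>auto simp: slope_line_horizontal Dir_slope_line\<close>)

lemma Dir_eq_vertical_dir_iff:
  assumes "c \<in> K"
  shows "L \<in> horizontal_lines R \<and> Dir R L = vertical_dir c \<longleftrightarrow> L \<in> vertical_line c ` K"
proof
  assume "L \<in> horizontal_lines R \<and> Dir R L = vertical_dir c"
  then have L: "L \<in> horizontal_lines R" and d: "Dir R L = vertical_dir c" by auto
  from L show "L \<in> vertical_line c ` K"
  proof (cases rule: horizontal_line_cases)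
    case (slope b' c' t)
    then show ?thesis
      using d slope_dir_neq_vertical_dir[of b' c' c] by (auto simp: Dir_slope_line)
  next
    case (vertical c' t)
    then show ?thesis using d assms vertical_dir_inject[of c c'] by (auto simp: Dir_vertical_line)
  qed
qed (use assms in \<open>auto simp: vertical_line_horizontal Dir_vertical_line\<close>)

lemma sum_slope_line:
  "(\<Sum>p\<in>slope_line b c t. f p) = (\<Sum>s\<in>K. f (s, s \<otimes> b \<oplus> c, t \<ominus> s \<otimes> c))"
  unfolding slope_line_def by (subst sum.reindex) (auto intro: inj_onI)

lemma sum_vertical_line:
  "(\<Sum>p\<in>vertical_line c t. f p) = (\<Sum>s\<in>K. f (c, s, t \<oplus> s \<otimes> c))"
  unfolding vertical_line_def by (subst sum.reindex) (auto intro: inj_onI)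

lemma card_horizontal_line:
  assumes "L \<in> horizontal_lines R" shows "card L = order R"
  using assms
proof (cases rule: horizontal_line_cases)
  case (slope b c t)
  then show ?thesis using sum_slope_line[of "\<lambda>_. 1 :: nat" b c t] by simp
next
  case (vertical c t)
  then show ?thesis using sum_vertical_line[of "\<lambda>_. 1 :: nat" c t] by simp
qed

lemma horizontal_line_subset:
  assumes "L \<in> horizontal_lines R" shows "L \<subseteq> K \<times> K \<times> K"
  using assms by (cases rule: horizontal_line_cases) (auto simp: slope_line_def vertical_line_def)

lemma finite_horizontal_line: "L \<in> horizontal_lines R \<Longrightarrow> finite L"
  by (rule finite_subset[OF horizontal_line_subset]) auto

lemma finite_refined_directions [simp]: "finite (refined_directions R)"
  by (simp add: refined_directions_eq)

lemma inj_on_slope_dir: "inj_on (\<lambda>(b, c). slope_dir b c) (K \<times> K)"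
proof (rule inj_onI, clarify)
  fix b c b' c' assume "b \<in> K" "c \<in> K" "b' \<in> K" "c' \<in> K" "slope_dir b c = slope_dir b' c'"
  then show "b = b' \<and> c = c'" by (rule slope_dir_inject)
qed

lemma card_slope_dirs: "card ((\<lambda>(b, c). slope_dir b c) ` (K \<times> K)) = (order R)\<^sup>2"
  by (simp add: card_image inj_on_slope_dir card_cartesian_product power2_eq_square)

text \<open>The exact count is \<open>q\<^sup>2 + q\<close>. The lower bound serves Kakeya sets, the
  upper bound the comparison of norms over directions.\<close>

lemma card_refined_directions:
  "(order R)\<^sup>2 \<le> card (refined_directions R)" "card (refined_directions R) \<le> 2 * (order R)\<^sup>2"
proof -
  show "(order R)\<^sup>2 \<le> card (refined_directions R)"
    unfolding card_slope_dirs[symmetric] by (intro card_mono) (auto simp: refined_directions_eq)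
  have "card (refined_directions R) \<le> (order R)\<^sup>2 + card (vertical_dir ` K)"
    unfolding refined_directions_eq card_slope_dirs[symmetric] by (rule card_Un_le)
  moreover have "card (vertical_dir ` K) \<le> order R" using card_image_le[OF finite_carrier] by simp
  moreover have "order R \<le> (order R)\<^sup>2" by (simp add: power2_eq_square)
  ultimately show "card (refined_directions R) \<le> 2 * (order R)\<^sup>2" by linarith
qed

lemma refined_directions_nonempty: "refined_directions R \<noteq> {}"
  by (auto simp: refined_directions_eq)

section \<open>The maximal function and its bound on square sums\<close>

lemma maximal_rd_attained:
  assumes "w \<in> refined_directions R"
  shows "\<exists>L. L \<in> horizontal_lines R \<and> Dir R L = w \<and> maximal_rd R F w = (\<Sum>p\<in>L. cmod (F p))"
    and "L \<in> horizontal_lines R \<Longrightarrow> Dir R L = w \<Longrightarrow> (\<Sum>p\<in>L. cmod (F p)) \<le> maximal_rd R F w"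
proof -
  define S where "S = {L. L \<in> horizontal_lines R \<and> Dir R L = w}"
  \<comment> \<open>\<open>Max\<close> is meaningful only on a finite nonempty set, so both
    properties come first.\<close>
  have S: "finite S" "S \<noteq> {}"
    using assms unfolding S_def refined_directions_eq
    by (auto simp: Dir_eq_slope_dir_iff Dir_eq_vertical_dir_iff)
  have M: "maximal_rd R F w = Max ((\<lambda>L. \<Sum>p\<in>L. cmod (F p)) ` S)"
    unfolding maximal_rd_def S_def by (rule arg_cong[where f = Max]) auto
  have "maximal_rd R F w \<in> (\<lambda>L. \<Sum>p\<in>L. cmod (F p)) ` S"
    unfolding M using S by (intro Max_in) auto
  then show "\<exists>L. L \<in> horizontal_lines R \<and> Dir R L = w \<and> maximal_rd R F w = (\<Sum>p\<in>L. cmod (F p))"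
    unfolding S_def by auto
  show "(\<Sum>p\<in>L. cmod (F p)) \<le> maximal_rd R F w" if "L \<in> horizontal_lines R" "Dir R L = w"
    unfolding M using S that by (intro Max_ge) (auto simp: S_def)
qed

lemma maximal_rd_nonneg:
  assumes "w \<in> refined_directions R" shows "0 \<le> maximal_rd R F w"
proof -
  obtain L where "maximal_rd R F w = (\<Sum>p\<in>L. cmod (F p))"
    using maximal_rd_attained(1)[OF assms, of F] by (elim exE conjE)
  then show ?thesis by (simp add: sum_nonneg)
qed

text \<open>Choose a maximising line above each direction. The slope directions contribute 6 and the
  vertical ones 1.\<close>

lemma sum_maximal_rd_sq:
  "(\<Sum>w\<in>refined_directions R. (maximal_rd R F w)\<^sup>2) \<le>
    7 * q * (\<Sum>p\<in>K \<times> K \<times> K. (cmod (F p))\<^sup>2)"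
proof -
  define G where "G p t = cmod (F (fst p, snd p, t))" for p t
  have "\<exists>t\<in>K. maximal_rd R F (slope_dir b c) = (\<Sum>s\<in>K. G (s, s \<otimes> b \<oplus> c) (t \<ominus> s \<otimes> c))"
    if bc: "b \<in> K" "c \<in> K" for b c
  proof -
    have "slope_dir b c \<in> refined_directions R" using bc by (auto simp: refined_directions_eq)
    from maximal_rd_attained(1)[OF this, of F] obtain L where L: "L \<in> horizontal_lines R"
      "Dir R L = slope_dir b c" "maximal_rd R F (slope_dir b c) = (\<Sum>p\<in>L. cmod (F p))" by (elim exE conjE)
    then have "L \<in> slope_line b c ` K" using Dir_eq_slope_dir_iff[OF bc] by blast
    then show ?thesis using L(3) by (auto simp: sum_slope_line G_def)
  qed
  then have "\<forall>p\<in>K \<times> K. \<exists>t. t \<in> K \<and> maximal_rd R F (slope_dir (fst p) (snd p)) =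
      (\<Sum>s\<in>K. G (s, s \<otimes> fst p \<oplus> snd p) (t \<ominus> s \<otimes> snd p))"
    by (auto simp: Bex_def)
  from bchoice[OF this] obtain T where "\<forall>p\<in>K \<times> K. T p \<in> K \<and> maximal_rd R F (slope_dir (fst p) (snd p)) =
      (\<Sum>s\<in>K. G (s, s \<otimes> fst p \<oplus> snd p) (T p \<ominus> s \<otimes> snd p))" ..
  then have t: "\<And>b c. b \<in> K \<Longrightarrow> c \<in> K \<Longrightarrow> T (b, c) \<in> K"
    "\<And>b c. b \<in> K \<Longrightarrow> c \<in> K \<Longrightarrow>
      maximal_rd R F (slope_dir b c) = (\<Sum>s\<in>K. G (s, s \<otimes> b \<oplus> c) (T (b, c) \<ominus> s \<otimes> c))"
    by auto
  have "\<exists>t\<in>K. maximal_rd R F (vertical_dir c) = (\<Sum>s\<in>K. G (c, s) (t \<oplus> s \<otimes> c))"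
    if c: "c \<in> K" for c
  proof -
    have "vertical_dir c \<in> refined_directions R" using c by (auto simp: refined_directions_eq)
    from maximal_rd_attained(1)[OF this, of F] obtain L where L: "L \<in> horizontal_lines R"
      "Dir R L = vertical_dir c" "maximal_rd R F (vertical_dir c) = (\<Sum>p\<in>L. cmod (F p))" by (elim exE conjE)
    then have "L \<in> vertical_line c ` K" using Dir_eq_vertical_dir_iff[OF c] by blast
    then show ?thesis using L(3) by (auto simp: sum_vertical_line G_def)
  qed
  then have "\<forall>c\<in>K. \<exists>t. t \<in> K \<and> maximal_rd R F (vertical_dir c) = (\<Sum>s\<in>K. G (c, s) (t \<oplus> s \<otimes> c))"
    by (auto simp: Bex_def)
  from bchoice[OF this] obtain T' where t': "\<forall>c\<in>K. T' c \<in> K \<and>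
      maximal_rd R F (vertical_dir c) = (\<Sum>s\<in>K. G (c, s) (T' c \<oplus> s \<otimes> c))" ..
  have "(\<Sum>w\<in>refined_directions R. (maximal_rd R F w)\<^sup>2) \<le>
      (\<Sum>w\<in>(\<lambda>(b, c). slope_dir b c) ` (K \<times> K). (maximal_rd R F w)\<^sup>2) +
      (\<Sum>w\<in>vertical_dir ` K. (maximal_rd R F w)\<^sup>2)"
    unfolding refined_directions_eq
    by (subst sum.union_disjoint) (use slope_dir_neq_vertical_dir in auto)
  also have "\<dots> \<le> (\<Sum>(b, c)\<in>K \<times> K. (maximal_rd R F (slope_dir b c))\<^sup>2) +
      (\<Sum>c\<in>K. (maximal_rd R F (vertical_dir c))\<^sup>2)"
    by (intro add_mono order_trans[OF sum_image_le]) (auto simp: case_prod_unfold)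
  also have "\<dots> = (\<Sum>b\<in>K. \<Sum>c\<in>K. (\<Sum>s\<in>K. G (s, s \<otimes> b \<oplus> c) (T (b, c) \<ominus> s \<otimes> c))\<^sup>2) +
      (\<Sum>c\<in>K. (\<Sum>s\<in>K. G (c, s) (T' c \<oplus> s \<otimes> c))\<^sup>2)"
    by (simp add: sum.cartesian_product' t t')
  also have "\<dots> \<le> 6 * q * (\<Sum>p\<in>K \<times> K. \<Sum>t\<in>K. (G p t)\<^sup>2) + q * (\<Sum>p\<in>K \<times> K. \<Sum>t\<in>K. (G p t)\<^sup>2)"
    using t' by (intro add_mono sum_sq_slope_lines[of "\<lambda>b c. T (b, c)"] sum_sq_vertical_lines t) auto
  also have "\<dots> = 7 * q * (\<Sum>p\<in>K \<times> K \<times> K. (cmod (F p))\<^sup>2)"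
    by (simp add: G_def sum.cartesian_product')
  finally show ?thesis .
qed

end

subsection \<open>Norms on finite sets\<close>

text \<open>Hoelder with conjugate exponents \<open>1 / \<theta>\<close> and
  \<open>1 / (1 - \<theta>)\<close>: normalise both sums to 1 and apply the weighted AM-GM
  inequality termwise. If a sum vanishes, so does every product, since
  \<open>0 powr x = 0\<close>.\<close>

lemma Holder_sum_powr:
  fixes f g :: "'c \<Rightarrow> real"
  assumes "finite A" "\<And>x. x \<in> A \<Longrightarrow> 0 \<le> f x" "\<And>x. x \<in> A \<Longrightarrow> 0 \<le> g x" "0 < \<theta>" "\<theta> < 1"
  shows "(\<Sum>x\<in>A. f x powr \<theta> * g x powr (1 - \<theta>)) \<le> (\<Sum>x\<in>A. f x) powr \<theta> * (\<Sum>x\<in>A. g x) powr (1 - \<theta>)"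
proof (cases "sum f A = 0 \<or> sum g A = 0")
  case True
  then have "f x = 0 \<or> g x = 0" if "x \<in> A" for x
    using that assms by (auto simp: sum_nonneg_eq_0_iff)
  then have "(\<Sum>x\<in>A. f x powr \<theta> * g x powr (1 - \<theta>)) = 0" by (intro sum.neutral) fastforce
  then show ?thesis by simp
next
  case False
  define S T where "S = sum f A" "T = sum g A"
  have ST: "S > 0" "T > 0" using False assms by (auto simp: S_T_def order_less_le sum_nonneg)
  have "f x powr \<theta> * g x powr (1 - \<theta>) \<le> S powr \<theta> * T powr (1 - \<theta>) * (\<theta> * (f x / S) + (1 - \<theta>) * (g x / T))"
    if x: "x \<in> A" for x
  proof (cases "f x = 0 \<or> g x = 0")
    case True
    then show ?thesis using assms(2,3)[OF x] assms(4,5) ST by auto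
  next
    case False
    then have pos: "f x > 0" "g x > 0" using assms(2,3)[OF x] by auto
    have "f x powr \<theta> * g x powr (1 - \<theta>) =
        S powr \<theta> * T powr (1 - \<theta>) * ((f x / S) powr \<theta> * (g x / T) powr (1 - \<theta>))"
      using pos ST by (simp add: powr_divide field_simps)
    also have "\<dots> \<le> S powr \<theta> * T powr (1 - \<theta>) * (\<theta> * (f x / S) + (1 - \<theta>) * (g x / T))"
      using pos ST assms(4,5) by (intro mult_left_mono Youngs_inequality_0) auto
    finally show ?thesis .
  qed
  then have "(\<Sum>x\<in>A. f x powr \<theta> * g x powr (1 - \<theta>)) \<le>
      (\<Sum>x\<in>A. S powr \<theta> * T powr (1 - \<theta>) * (\<theta> * (f x / S) + (1 - \<theta>) * (g x / T)))"
    by (rule sum_mono)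
  also have "\<dots> = S powr \<theta> * T powr (1 - \<theta>) * (\<theta> * (S / S) + (1 - \<theta>) * (T / T))"
    by (simp only: S_T_def sum.distrib sum_divide_distrib flip: sum_distrib_left)
  also have "\<dots> = S powr \<theta> * T powr (1 - \<theta>)" using ST by simp
  finally show ?thesis by (simp add: S_T_def)
qed

text \<open>Each term is at most the total, so \<open>b x powr p\<close> is at most
  \<open>b x\<close> times the total to the power \<open>p - 1\<close>.\<close>

lemma sum_powr_le_powr_sum:
  fixes b :: "'c \<Rightarrow> real"
  assumes "finite A" "\<And>x. x \<in> A \<Longrightarrow> 0 \<le> b x" "1 \<le> p"
  shows "(\<Sum>x\<in>A. b x powr p) \<le> (\<Sum>x\<in>A. b x) powr p"
proof -
  have S: "0 \<le> sum b A" using assms by (simp add: sum_nonneg)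
  have split: "y powr p = y * y powr (p - 1)" if "0 \<le> y" for y :: real
    using that assms(3) by (cases "y = 0") (auto simp: powr_diff)
  have "(\<Sum>x\<in>A. b x powr p) \<le> (\<Sum>x\<in>A. b x * sum b A powr (p - 1))"
    using assms by (intro sum_mono) (auto simp: split intro!: mult_left_mono powr_mono2 member_le_sum)
  also have "\<dots> = sum b A powr p" by (simp add: split[OF S] sum_distrib_right)
  finally show ?thesis .
qed

lemma lp_norm_ennreal:
  assumes "0 \<le> p"
  shows "lp_norm (ennreal p) X f = (\<Sum>x\<in>X. norm (f x) powr p) powr (1 / p)"
  using assms by (simp add: lp_norm_def)

lemma lp_norm_nonneg:
  assumes "finite X" "X \<noteq> {}" shows "0 \<le> lp_norm p X f"
proof (cases "p = \<infinity>")
  case True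
  have "\<exists>x\<in>X. 0 \<le> norm (f x)" using assms by auto
  then show ?thesis using True assms by (simp add: lp_norm_def Max_ge_iff)
qed (simp add: lp_norm_def)

text \<open>For finite exponents, apply \<open>sum_powr_le_powr_sum\<close> to the powers
  \<open>norm (f x) powr p\<close> with exponent \<open>r / p\<close>; for the sup norm, keep a
  single term.\<close>

lemma lp_norm_antimono:
  fixes f :: "'c \<Rightarrow> 'd::real_normed_vector"
  assumes "finite X" "X \<noteq> {}" "1 \<le> p" "ennreal p \<le> w"
  shows "lp_norm w X f \<le> lp_norm (ennreal p) X f"
proof (cases w)
  case (real r)
  then have r: "p \<le> r" using assms by simp
  have "(\<Sum>x\<in>X. norm (f x) powr r) = (\<Sum>x\<in>X. (norm (f x) powr p) powr (r / p))"
    using assms by (simp add: powr_powr)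
  also have "\<dots> \<le> (\<Sum>x\<in>X. norm (f x) powr p) powr (r / p)"
    using assms r by (intro sum_powr_le_powr_sum) auto
  finally have "(\<Sum>x\<in>X. norm (f x) powr r) powr (1 / r) \<le>
      ((\<Sum>x\<in>X. norm (f x) powr p) powr (r / p)) powr (1 / r)"
    using r assms by (intro powr_mono2) (auto intro: sum_nonneg)
  also have "\<dots> = (\<Sum>x\<in>X. norm (f x) powr p) powr (1 / p)"
    using r assms by (simp add: powr_powr)
  finally show ?thesis using real r assms by (simp add: lp_norm_ennreal)
next
  case top
  have "norm (f x) \<le> (\<Sum>x\<in>X. norm (f x) powr p) powr (1 / p)" if "x \<in> X" for x
  proof -
    have "norm (f x) = (norm (f x) powr p) powr (1 / p)" using assms by (simp add: powr_powr)
    also have "\<dots> \<le> (\<Sum>x\<in>X. norm (f x) powr p) powr (1 / p)"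
      using assms that by (intro powr_mono2 member_le_sum[where f = "\<lambda>x. norm (f x) powr p"]) auto
    finally show ?thesis .
  qed
  then show ?thesis using top assms by (simp add: lp_norm_def)
qed

lemma lp_norm_le_card_mult:
  fixes f :: "'c \<Rightarrow> 'd::real_normed_vector"
  assumes "finite X" "1 \<le> r" "r \<le> u"
  shows "lp_norm (ennreal r) X f \<le> real (card X) powr (1 / r - 1 / u) * lp_norm (ennreal u) X f"
\<comment> \<open>Equality is separate because \<open>Holder_sum_powr\<close> needs its exponent
  \<open>r / u\<close> strictly below 1.\<close>
proof (cases "r = u")
  case True
  then show ?thesis using assms by (cases "X = {}") (auto simp: lp_norm_ennreal)
next
  case False
  then have ru: "r < u" using assms by simp
  have e: "(norm (f x) powr u) powr (r / u) = norm (f x) powr r" for x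
    using assms by (simp add: powr_powr)
  have "(\<Sum>x\<in>X. norm (f x) powr r) \<le> (\<Sum>x\<in>X. norm (f x) powr u) powr (r / u) * real (card X) powr (1 - r / u)"
    using Holder_sum_powr[of X "\<lambda>x. norm (f x) powr u" "\<lambda>_. 1" "r / u"] assms ru by (simp add: e)
  then have "(\<Sum>x\<in>X. norm (f x) powr r) powr (1 / r) \<le>
      ((\<Sum>x\<in>X. norm (f x) powr u) powr (r / u) * real (card X) powr (1 - r / u)) powr (1 / r)"
    using assms by (intro powr_mono2) (auto intro: sum_nonneg)
  also have "\<dots> = real (card X) powr (1 / r - 1 / u) * (\<Sum>x\<in>X. norm (f x) powr u) powr (1 / u)"
  proof -
    have "(1 - r / u) * (1 / r) = 1 / r - 1 / u" "r / u * (1 / r) = 1 / u"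
      using assms by (auto simp: field_simps)
    then show ?thesis using assms by (simp add: powr_mult powr_powr sum_nonneg mult.commute)
  qed
  finally show ?thesis using assms by (simp add: lp_norm_ennreal)
qed

lemma lp_norm_ge:
  fixes f :: "'c \<Rightarrow> 'd::real_normed_vector"
  assumes "finite X" "W \<subseteq> X" "W \<noteq> {}" "1 \<le> v" "0 \<le> m" "\<And>x. x \<in> W \<Longrightarrow> m \<le> norm (f x)"
  shows "m * real (card W) powr (1 / enn2real v) \<le> lp_norm v X f"
proof (cases v)
  case (real r)
  then have r: "1 \<le> r" using assms(4) by simp
  have fin: "finite W" using assms finite_subset by blast
  have "m * real (card W) powr (1 / r) = (\<Sum>x\<in>W. m powr r) powr (1 / r)"
    using r assms(5) by (simp add: powr_mult powr_powr mult.commute)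
  also have "\<dots> \<le> (\<Sum>x\<in>W. norm (f x) powr r) powr (1 / r)"
    using r assms(5,6) by (intro powr_mono2 sum_mono) (auto intro: sum_nonneg)
  also have "\<dots> \<le> (\<Sum>x\<in>X. norm (f x) powr r) powr (1 / r)"
    using r assms by (intro powr_mono2 sum_mono2) (auto intro: sum_nonneg)
  finally show ?thesis using real r by (simp add: lp_norm_ennreal)
next
  case top
  obtain x where x: "x \<in> W" using assms by auto
  \<comment> \<open>For \<open>v = \<infinity>\<close> the exponent \<open>1 / enn2real v\<close> is
    \<open>1 / 0 = 0\<close>. The factor \<open>card W powr 0\<close> is then 1, as \<open>W\<close>
    is nonempty; \<open>0 powr 0\<close> would be 0.\<close>
  have "card W \<noteq> 0" using assms finite_subset[OF assms(2,1)] by auto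
  moreover have "m \<le> Max ((\<lambda>x. norm (f x)) ` X)"
    using x assms by (intro order_trans[OF assms(6)[OF x]] Max_ge) auto
  ultimately show ?thesis using top by (simp add: lp_norm_def)
qed

lemma lp_norm_indicator:
  assumes "finite X" "E \<subseteq> X" "1 \<le> u"
  shows "lp_norm (ennreal u) X (indicator E :: 'c \<Rightarrow> complex) = real (card E) powr (1 / u)"
proof -
  have "(\<Sum>x\<in>X. norm (indicator E x :: complex) powr u) = (\<Sum>x\<in>X. indicator E x)"
    by (intro sum.cong refl) (auto simp: indicator_def)
  also have "\<dots> = real (card E)" using assms by (simp add: indicator_def Int_absorb1)
  finally show ?thesis using assms by (simp add: lp_norm_ennreal)
qed

subsection \<open>Estimates for the maximal function\<close>

context finite_field begin

lemma lp_norm_directions: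
  assumes "0 \<le> p"
  shows "lp_norm (ennreal p) (refined_directions R) (maximal_rd R F) =
    (\<Sum>w\<in>refined_directions R. maximal_rd R F w powr p) powr (1 / p)"
  using assms by (simp add: lp_norm_ennreal maximal_rd_nonneg abs_of_nonneg cong: sum.cong)

text \<open>The line that maximises the sum of \<open>cmod F\<close> competes in the maximal
  function of \<open>cmod F powr (u / 2)\<close>. The exponent \<open>u / 2\<close> is the one whose
  square sum is the \<open>u\<close>-th power sum of \<open>F\<close>.\<close>

lemma sum_le_powr_maximal_rd:
  assumes u: "1 \<le> u" and w: "w \<in> refined_directions R"
    and N: "\<And>L. L \<in> horizontal_lines R \<Longrightarrow> (\<Sum>p\<in>L. cmod (F p)) powr v \<le> N * (\<Sum>p\<in>L. cmod (F p) powr (u / 2))\<^sup>2"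
    and "0 \<le> N"
  shows "maximal_rd R F w powr v \<le> N * (maximal_rd R (\<lambda>p. complex_of_real (cmod (F p) powr (u / 2))) w)\<^sup>2"
proof -
  obtain L where L: "L \<in> horizontal_lines R" "Dir R L = w" "maximal_rd R F w = (\<Sum>p\<in>L. cmod (F p))"
    using maximal_rd_attained(1)[OF w, of F] by (elim exE conjE)
  have "(\<Sum>p\<in>L. cmod (F p) powr (u / 2)) \<le>
      maximal_rd R (\<lambda>p. complex_of_real (cmod (F p) powr (u / 2))) w"
    using maximal_rd_attained(2)[OF w L(1,2), of "\<lambda>p. complex_of_real (cmod (F p) powr (u / 2))"] by simp
  then have "(\<Sum>p\<in>L. cmod (F p) powr (u / 2))\<^sup>2 \<le>
      (maximal_rd R (\<lambda>p. complex_of_real (cmod (F p) powr (u / 2))) w)\<^sup>2"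
    by (intro power_mono) (auto intro: sum_nonneg)
  then show ?thesis using N[OF L(1)] \<open>0 \<le> N\<close> L(3) by (smt (verit) mult_left_mono)
qed

text \<open>
  A pointwise comparison with the maximal function of \<open>cmod F powr (u / 2)\<close> reduces all estimates
  to the one on \<open>\<ell>\<^sup>2\<close>.
\<close>

lemma lp_norm_maximal_rd_le:
  assumes u: "1 \<le> u" and v: "1 \<le> v"
    and N: "\<And>L. L \<in> horizontal_lines R \<Longrightarrow> (\<Sum>p\<in>L. cmod (F p)) powr v \<le> N * (\<Sum>p\<in>L. cmod (F p) powr (u / 2))\<^sup>2"
    and "0 \<le> N"
  shows "lp_norm (ennreal v) (refined_directions R) (maximal_rd R F) \<le>
    7 * (N * q * (\<Sum>p\<in>K \<times> K \<times> K. cmod (F p) powr u)) powr (1 / v)"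
proof -
  let ?G = "\<lambda>p. complex_of_real (cmod (F p) powr (u / 2))"
  let ?S = "\<Sum>p\<in>K \<times> K \<times> K. cmod (F p) powr u"
  have S: "0 \<le> ?S" by (intro sum_nonneg) auto
  have "(\<Sum>w\<in>refined_directions R. maximal_rd R F w powr v) \<le>
      (\<Sum>w\<in>refined_directions R. N * (maximal_rd R ?G w)\<^sup>2)"
    by (intro sum_mono sum_le_powr_maximal_rd assms)
  also have "\<dots> = N * (\<Sum>w\<in>refined_directions R. (maximal_rd R ?G w)\<^sup>2)"
    by (simp add: sum_distrib_left)
  also have "\<dots> \<le> N * (7 * q * (\<Sum>p\<in>K \<times> K \<times> K. (cmod (?G p))\<^sup>2))"
    by (intro mult_left_mono sum_maximal_rd_sq \<open>0 \<le> N\<close>)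
  also have "(\<Sum>p\<in>K \<times> K \<times> K. (cmod (?G p))\<^sup>2) = ?S"
    by (intro sum.cong refl) (simp add: power2_eq_square flip: powr_add)
  finally have "lp_norm (ennreal v) (refined_directions R) (maximal_rd R F) \<le> (N * (7 * q * ?S)) powr (1 / v)"
    using v by (simp add: lp_norm_directions powr_mono2 sum_nonneg)
  also have "\<dots> = 7 powr (1 / v) * (N * q * ?S) powr (1 / v)"
    using S \<open>0 \<le> N\<close> by (simp add: mult_ac flip: powr_mult)
  also have "\<dots> \<le> 7 powr 1 * (N * q * ?S) powr (1 / v)"
    using v by (intro mult_right_mono powr_mono) auto
  finally show ?thesis by simp
qed

text \<open>Hoelder against 1 on a line of \<open>q\<close> points gives the comparison factor
  \<open>q powr (u - 2)\<close>. With the \<open>q\<close> of the square-sum bound this is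
  \<open>q powr (u - 1)\<close>, and the \<open>u\<close>-th root yields the exponent.\<close>

lemma maximal_rd_estimate_ge_2:
  assumes u: "2 \<le> u"
  shows "lp_norm (ennreal u) (refined_directions R) (maximal_rd R F) \<le>
    7 * q powr (1 - 1 / u) * lp_norm (ennreal u) (carrier (heisenberg R)) F"
proof -
  have q: "q > 0" using order_ge_2 by simp
  have "(\<Sum>p\<in>L. cmod (F p)) powr u \<le> q powr (u - 2) * (\<Sum>p\<in>L. cmod (F p) powr (u / 2))\<^sup>2"
    if L: "L \<in> horizontal_lines R" for L
  proof (cases "u = 2")
    case False
    then have u2: "u > 2" using u by simp
    have e: "(cmod (F p) powr (u / 2)) powr (2 / u) = cmod (F p)" for p
      using u by (simp add: powr_powr)
    have "(\<Sum>p\<in>L. cmod (F p)) \<le> (\<Sum>p\<in>L. cmod (F p) powr (u / 2)) powr (2 / u) * q powr (1 - 2 / u)"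
      using Holder_sum_powr[OF finite_horizontal_line[OF L], of "\<lambda>p. cmod (F p) powr (u / 2)" "\<lambda>_. 1" "2 / u"] u2
      by (simp add: e card_horizontal_line[OF L])
    then have "(\<Sum>p\<in>L. cmod (F p)) powr u \<le>
        ((\<Sum>p\<in>L. cmod (F p) powr (u / 2)) powr (2 / u) * q powr (1 - 2 / u)) powr u"
      using u by (intro powr_mono2) (auto intro: sum_nonneg)
    also have "\<dots> = (\<Sum>p\<in>L. cmod (F p) powr (u / 2)) powr 2 * q powr (u - 2)"
    proof -
      have "(1 - 2 / u) * u = u - 2" "2 / u * u = 2" using u by (auto simp: field_simps)
      then show ?thesis by (simp add: powr_mult powr_powr)
    qed
    also have "\<dots> = q powr (u - 2) * (\<Sum>p\<in>L. cmod (F p) powr (u / 2))\<^sup>2"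
      by (simp add: sum_nonneg powr_numeral)
    finally show ?thesis .
  qed (use q in \<open>simp add: powr_numeral sum_nonneg\<close>)
  then have "lp_norm (ennreal u) (refined_directions R) (maximal_rd R F) \<le>
      7 * (q powr (u - 2) * q * (\<Sum>p\<in>K \<times> K \<times> K. cmod (F p) powr u)) powr (1 / u)"
    using u by (intro lp_norm_maximal_rd_le) auto
  also have "q powr (u - 2) * q = q powr (u - 1)" using q by (simp add: powr_diff power2_eq_square)
  also have "7 * (q powr (u - 1) * (\<Sum>p\<in>K \<times> K \<times> K. cmod (F p) powr u)) powr (1 / u) =
      7 * q powr (1 - 1 / u) * lp_norm (ennreal u) (carrier (heisenberg R)) F"
  proof -
    have "(u - 1) * (1 / u) = 1 - 1 / u" using u by (simp add: field_simps)
    then show ?thesis using u by (simp add: lp_norm_ennreal powr_mult powr_powr sum_nonneg)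
  qed
  finally show ?thesis .
qed

text \<open>Here \<open>2 / u \<ge> 1\<close>, so superadditivity of powers replaces Hoelder and the
  comparison factor is 1.\<close>

lemma maximal_rd_estimate_le_2:
  assumes u: "1 \<le> u" "u \<le> 2"
  shows "lp_norm (ennreal u) (refined_directions R) (maximal_rd R F) \<le>
    7 * q powr (1 / u) * lp_norm (ennreal u) (carrier (heisenberg R)) F"
proof -
  have "(\<Sum>p\<in>L. cmod (F p)) powr u \<le> 1 * (\<Sum>p\<in>L. cmod (F p) powr (u / 2))\<^sup>2"
    if L: "L \<in> horizontal_lines R" for L
  proof -
    have e: "(cmod (F p) powr (u / 2)) powr (2 / u) = cmod (F p)" for p
      using u by (simp add: powr_powr)
    have "(\<Sum>p\<in>L. cmod (F p)) \<le> (\<Sum>p\<in>L. cmod (F p) powr (u / 2)) powr (2 / u)"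
      using sum_powr_le_powr_sum[OF finite_horizontal_line[OF L], of "\<lambda>p. cmod (F p) powr (u / 2)" "2 / u"] u
      by (simp add: e)
    then have "(\<Sum>p\<in>L. cmod (F p)) powr u \<le> ((\<Sum>p\<in>L. cmod (F p) powr (u / 2)) powr (2 / u)) powr u"
      using u by (intro powr_mono2) (auto intro: sum_nonneg)
    also have "\<dots> = (\<Sum>p\<in>L. cmod (F p) powr (u / 2))\<^sup>2"
      using u by (simp add: powr_powr sum_nonneg powr_numeral)
    finally show ?thesis by simp
  qed
  then have "lp_norm (ennreal u) (refined_directions R) (maximal_rd R F) \<le>
      7 * (1 * q * (\<Sum>p\<in>K \<times> K \<times> K. cmod (F p) powr u)) powr (1 / u)"
    using u by (intro lp_norm_maximal_rd_le) auto
  then show ?thesis using u by (simp add: lp_norm_ennreal powr_mult sum_nonneg)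
qed

text \<open>For conjugate exponents, Hoelder on a line splits \<open>cmod F\<close> into a power of
  \<open>cmod F powr (u / 2)\<close> and a power of \<open>cmod F powr u\<close>. The sum of the
  latter over the line is at most its sum \<open>S\<close> over the whole group, so the comparison
  factor \<open>S powr (v - 2)\<close> depends on \<open>F\<close>.\<close>

lemma maximal_rd_estimate_dual:
  assumes v: "2 \<le> v" and u: "u = v / (v - 1)"
  shows "lp_norm (ennreal v) (refined_directions R) (maximal_rd R F) \<le>
    7 * q powr (1 / v) * lp_norm (ennreal u) (carrier (heisenberg R)) F"
proof (cases "v = 2")
  case True
  then show ?thesis using maximal_rd_estimate_le_2[of 2 F] u by simp
next
  case False
  then have v2: "v > 2" using v by simp
  have u1: "1 \<le> u" using v by (simp add: u field_simps)
  define S where "S = (\<Sum>p\<in>K \<times> K \<times> K. cmod (F p) powr u)"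
  have S: "0 \<le> S" unfolding S_def by (intro sum_nonneg) auto
  have "(\<Sum>p\<in>L. cmod (F p)) powr v \<le> S powr (v - 2) * (\<Sum>p\<in>L. cmod (F p) powr (u / 2))\<^sup>2"
    if L: "L \<in> horizontal_lines R" for L
  proof -
    have e: "(cmod (F p) powr (u / 2)) powr (2 / v) * (cmod (F p) powr u) powr (1 - 2 / v) = cmod (F p)" for p
    proof -
      have "u / 2 * (2 / v) + u * (1 - 2 / v) = 1" using u v by (simp add: field_simps)
      then show ?thesis by (simp add: powr_powr flip: powr_add)
    qed
    have "(\<Sum>p\<in>L. cmod (F p)) \<le> (\<Sum>p\<in>L. cmod (F p) powr (u / 2)) powr (2 / v) *
        (\<Sum>p\<in>L. cmod (F p) powr u) powr (1 - 2 / v)"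
      using Holder_sum_powr[OF finite_horizontal_line[OF L], of "\<lambda>p. cmod (F p) powr (u / 2)"
        "\<lambda>p. cmod (F p) powr u" "2 / v"] v2 by (simp add: e)
    also have "\<dots> \<le> (\<Sum>p\<in>L. cmod (F p) powr (u / 2)) powr (2 / v) * S powr (1 - 2 / v)"
      unfolding S_def using v horizontal_line_subset[OF L]
      by (intro mult_left_mono powr_mono2 sum_mono2) (auto intro: sum_nonneg)
    finally have "(\<Sum>p\<in>L. cmod (F p)) powr v \<le>
        ((\<Sum>p\<in>L. cmod (F p) powr (u / 2)) powr (2 / v) * S powr (1 - 2 / v)) powr v"
      using v by (intro powr_mono2) (auto intro: sum_nonneg)
    also have "\<dots> = (\<Sum>p\<in>L. cmod (F p) powr (u / 2)) powr 2 * S powr (v - 2)"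
    proof -
      have "(1 - 2 / v) * v = v - 2" "2 / v * v = 2" using v by (auto simp: field_simps)
      then show ?thesis by (simp add: powr_mult powr_powr)
    qed
    also have "\<dots> = S powr (v - 2) * (\<Sum>p\<in>L. cmod (F p) powr (u / 2))\<^sup>2"
      by (simp add: sum_nonneg powr_numeral)
    finally show ?thesis .
  qed
  then have "lp_norm (ennreal v) (refined_directions R) (maximal_rd R F) \<le>
      7 * (S powr (v - 2) * q * S) powr (1 / v)"
    unfolding S_def using u1 v by (intro lp_norm_maximal_rd_le) auto
  also have "S powr (v - 2) * q * S = q * S powr (v - 1)"
    using S by (cases "S = 0") (simp_all add: powr_diff power2_eq_square)
  also have "7 * (q * S powr (v - 1)) powr (1 / v) =
      7 * q powr (1 / v) * lp_norm (ennreal u) (carrier (heisenberg R)) F"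
  proof -
    have "(v - 1) * (1 / v) = 1 / u" by (simp add: u)
    then show ?thesis using u1 by (simp add: lp_norm_ennreal powr_mult powr_powr S_def)
  qed
  finally show ?thesis .
qed

lemma maximal_rd_estimate_top:
  "lp_norm \<infinity> (refined_directions R) (maximal_rd R F) \<le> lp_norm 1 (carrier (heisenberg R)) F"
proof -
  have "maximal_rd R F w \<le> (\<Sum>p\<in>K \<times> K \<times> K. cmod (F p))" if w: "w \<in> refined_directions R" for w
  proof -
    obtain L where L: "L \<in> horizontal_lines R" "maximal_rd R F w = (\<Sum>p\<in>L. cmod (F p))"
      using maximal_rd_attained(1)[OF w, of F] by (elim exE conjE)
    then show ?thesis using horizontal_line_subset[OF L(1)] by (simp add: sum_mono2)
  qed
  then show ?thesis
    using refined_directions_nonempty lp_norm_ennreal[of 1 "K \<times> K \<times> K" F]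
    by (simp add: lp_norm_def maximal_rd_nonneg sum_nonneg)
qed

end

text \<open>
  The terms are the lower bounds for the exponent obtained from the indicators of the whole group, of
  a line tested on all lines crossing it, of a point, and of a line tested on its own direction. Here
  \<open>\<mu> = 1 / u\<close> and \<open>\<delta> = 1 / v\<close>; for \<open>v = \<infinity>\<close> the value \<open>1 / enn2real v = 0\<close> is the intended one.
\<close>

definition critical_exponent :: "real \<Rightarrow> real \<Rightarrow> real" where
  "critical_exponent \<mu> \<delta> = max (max (1 + 2 * \<delta> - 3 * \<mu>) (2 * \<delta> - \<mu>)) (max \<delta> (1 - \<mu>))"

section \<open>Upper and lower bounds at the critical exponent\<close>

context finite_field begin

lemma card_directions_powr_le:
  assumes "0 \<le> x" "x \<le> 1"
  shows "real (card (refined_directions R)) powr x \<le> 2 * q powr (2 * x)"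
proof -
  have "real (card (refined_directions R)) \<le> real (2 * (order R)\<^sup>2)"
    using card_refined_directions(2) by (rule of_nat_mono)
  then have "real (card (refined_directions R)) powr x \<le> (2 * q\<^sup>2) powr x"
    using assms by (intro powr_mono2) auto
  also have "\<dots> = 2 powr x * q powr (2 * x)"
    using order_ge_2 by (simp add: powr_mult powr_powr flip: powr_numeral)
  also have "\<dots> \<le> 2 powr 1 * q powr (2 * x)"
    using assms by (intro mult_right_mono powr_mono) auto
  finally show ?thesis by simp
qed

text \<open>Each region of the square of pairs \<open>(1 / u, 1 / v)\<close> is reached from the
  diagonal or from the line \<open>1/u + 1/v = 1\<close>. For \<open>v \<le> u\<close>, Hoelder over
  the directions costs a factor 2, whence \<open>14 = 2 * 7\<close>; the other regions use nesting
  of norms.\<close>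

lemma lp_norm_maximal_rd_le_critical:
  assumes u: "1 \<le> u" and v: "1 \<le> v"
  shows "lp_norm v (refined_directions R) (maximal_rd R F) \<le>
    14 * q powr critical_exponent (1 / u) (1 / enn2real v) * lp_norm (ennreal u) (carrier (heisenberg R)) F"
    (is "?M v \<le> 14 * q powr ?A * ?N u")
proof -
  have D: "finite (refined_directions R)" "refined_directions R \<noteq> {}"
    using refined_directions_nonempty by auto
  have H: "finite (carrier (heisenberg R))" "carrier (heisenberg R) \<noteq> {}" by auto
  have N0: "0 \<le> ?N w" for w by (intro lp_norm_nonneg H)
  have N_mono: "?N w \<le> ?N u" if "u \<le> w" for w
    using lp_norm_antimono[OF H u, of "ennreal w" F] that u by simp
  have M_mono: "?M v \<le> ?M (ennreal w)" if "1 \<le> w" "ennreal w \<le> v" for w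
    by (intro lp_norm_antimono D that)
  \<comment> \<open>Two relaxations at once: the power of \<open>q\<close> may grow to the critical
    one, and the norm of \<open>F\<close> may pass from \<open>w\<close> down to
    \<open>u\<close>.\<close>
  have crit: "?M v \<le> 14 * q powr ?A * ?N u" if "?M v \<le> 14 * q powr e * ?N w" "e \<le> ?A" "u \<le> w" for e w
  proof -
    have "14 * q powr e * ?N w \<le> 14 * q powr ?A * ?N u"
      using that order_ge_2 N_mono[of w] N0[of w] by (intro mult_mono powr_mono) auto
    then show ?thesis using that by simp
  qed
  have exps: "1 + 2 / enn2real v - 3 / u \<le> ?A" "2 / enn2real v - 1 / u \<le> ?A" "1 / enn2real v \<le> ?A"
    "1 - 1 / u \<le> ?A"
    by (auto simp: critical_exponent_def)
  have widen: "x \<le> 14 * y" if "x \<le> 7 * y" "0 \<le> x" for x y :: real using that by simp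
  have M0: "0 \<le> ?M w" for w by (intro lp_norm_nonneg D)
  consider (le) r where "v = ennreal r" "1 \<le> r" "r \<le> u" | (ge) "ennreal u \<le> v"
    using v by (cases v) (auto, metis ennreal_leI linear)
  then show ?thesis
  proof cases
    case le
    have r: "enn2real v = r" using le by simp
    have x: "0 \<le> 1 / r - 1 / u" "1 / r - 1 / u \<le> 1"
      using le u by (auto simp: frac_le intro: order_trans[of _ "1 / r"])
    have step: "?M v \<le> 14 * q powr (2 * (1 / r - 1 / u) + e) * ?N u" if "?M (ennreal u) \<le> 7 * q powr e * ?N u" for e
    proof -
      have "?M v \<le> real (card (refined_directions R)) powr (1 / r - 1 / u) * ?M (ennreal u)"
        unfolding le(1) using le by (intro lp_norm_le_card_mult D)
      also have "\<dots> \<le> (2 * q powr (2 * (1 / r - 1 / u))) * (7 * q powr e * ?N u)"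
        by (intro mult_mono card_directions_powr_le x that M0) auto
      finally show ?thesis by (simp add: powr_add mult_ac)
    qed
    show ?thesis
    proof (cases "u \<le> 2")
      case True
      have "2 * (1 / r - 1 / u) + 1 / u = 2 / enn2real v - 1 / u" by (simp add: r)
      then show ?thesis
        using crit[of "2 / enn2real v - 1 / u" u] step[OF maximal_rd_estimate_le_2[OF u True]] exps by simp
    next
      case False
      have e: "2 * (1 / r - 1 / u) + (1 - 1 / u) = 1 + 2 / enn2real v - 3 / u" by (simp add: r field_simps)
      have "?M v \<le> 14 * q powr (1 + 2 / enn2real v - 3 / u) * ?N u"
        using step[OF maximal_rd_estimate_ge_2[of u]] False unfolding e by simp
      then show ?thesis using crit exps by blast
    qed
  next
    case ge
    show ?thesis
    proof (cases "u \<ge> 2")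
      case True
      have "?M v \<le> 7 * (q powr (1 - 1 / u) * ?N u)"
        using M_mono[OF u ge] maximal_rd_estimate_ge_2[OF True, of F] by simp
      from widen[OF this M0] show ?thesis using crit[of "1 - 1 / u" u] exps by simp
    next
      case u2: False
      show ?thesis
      \<comment> \<open>The two sides of the line \<open>1/u + 1/v = 1\<close>. On the near side the
        term \<open>1 / v\<close> is used and only the norm of \<open>F\<close> is relaxed; on the
        far side it is \<open>1 - 1 / u\<close>, reached from the conjugate exponent of
        \<open>u\<close>.\<close>
      proof (cases "\<exists>r. v = ennreal r \<and> 1 \<le> r \<and> 1 - 1 / u \<le> 1 / r")
        case True
        then obtain r where r: "v = ennreal r" "1 \<le> r" "1 - 1 / u \<le> 1 / r" by blast
        then have ur: "u \<le> r" and rv: "enn2real v = r" using ge by auto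
        show ?thesis
        proof (cases "r \<le> 2")
          case True
          have "?M v \<le> 7 * (q powr (1 / r) * ?N r)"
            using maximal_rd_estimate_le_2[OF r(2) True, of F] by (simp add: r(1))
          from widen[OF this M0] show ?thesis using crit[of "1 / r" r] exps ur rv by simp
        next
          case False
          then have r2: "2 \<le> r" by simp
          have w: "u \<le> r / (r - 1)" using r(3) u r2 by (simp add: field_simps)
          have "?M v \<le> 7 * (q powr (1 / r) * ?N (r / (r - 1)))"
            using maximal_rd_estimate_dual[OF r2 refl, of F] by (simp add: r(1))
          from widen[OF this M0] show ?thesis using crit[of "1 / r" "r / (r - 1)"] exps w rv by simp
        qed
      next
        case far: False
        show ?thesis
        \<comment> \<open>The conjugate exponent of 1 is infinite. A finite \<open>v\<close> would
          satisfy \<open>1 - 1 / u = 0 \<le> 1 / v\<close>, so only \<open>v = \<infinity>\<close>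
          remains, where the critical exponent is 0.\<close>
        proof (cases "u = 1")
          case True
          have "v = \<infinity>"
          proof (cases v)
            case (real r)
            then show ?thesis using far True v by auto
          qed simp
          then have "?M v \<le> 14 * q powr 0 * ?N 1"
            using maximal_rd_estimate_top[of F] N0[of 1] order_ge_2 by simp
          then show ?thesis using crit[of 0 1] exps True by simp
        next
          case False
          define w where "w = u / (u - 1)"
          have u1: "1 < u" using False u by simp
          have w: "2 \<le> w" "w / (w - 1) = u" "1 / w = 1 - 1 / u"
            using u2 u1 by (auto simp: w_def field_simps)
          have "ennreal w \<le> v"
          proof (cases v)
            case (real r)
            then have "1 \<le> r" using v by simp
            then have "1 / r < 1 / w" using far real w by auto
            then have "w < r" using frac_le[of 1 1 r w] \<open>1 \<le> r\<close> by force
            then show ?thesis using real by (simp add: ennreal_leI)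
          qed simp
          then have "?M v \<le> 7 * (q powr (1 - 1 / u) * ?N u)"
            using M_mono[of w] maximal_rd_estimate_dual[OF w(1) refl, of F] w by simp
          from widen[OF this M0] show ?thesis using crit[of "1 - 1 / u" u] exps by simp
        qed
      qed
    qed
  qed
qed

text \<open>Stated for an arbitrary constant \<open>B\<close> because it is read both ways: as a
  lower bound for the size of \<open>E\<close>, and, for explicit \<open>E\<close>, as a lower bound
  for \<open>B\<close>.\<close>

lemma incidence_bound:
  assumes uv: "1 \<le> u" "1 \<le> v"
    and est: "lp_norm v (refined_directions R) (maximal_rd R (indicator E)) \<le>
      B * lp_norm (ennreal u) (carrier (heisenberg R)) (indicator E :: _ \<Rightarrow> complex)"
    and \<Omega>: "\<Omega> \<noteq> {}" "\<Omega> \<subseteq> refined_directions R" and E: "E \<subseteq> carrier (heisenberg R)"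
    and lines: "\<And>\<omega>. \<omega> \<in> \<Omega> \<Longrightarrow> \<exists>L\<in>horizontal_lines R. Dir R L = \<omega> \<and> m \<le> card (E \<inter> L)"
  shows "real m * real (card \<Omega>) powr (1 / enn2real v) \<le> B * real (card E) powr (1 / u)"
proof -
  have "real m \<le> norm (maximal_rd R (indicator E) \<omega>)" if w: "\<omega> \<in> \<Omega>" for \<omega>
  proof -
    obtain L where L: "L \<in> horizontal_lines R" "Dir R L = \<omega>" "m \<le> card (E \<inter> L)"
      using lines[OF w] by blast
    have "(\<Sum>p\<in>L. cmod (indicator E p)) = (\<Sum>p\<in>L. indicator E p)"
      by (intro sum.cong refl) (auto simp: indicator_def)
    also have "\<dots> = real (card (E \<inter> L))"
      using finite_horizontal_line[OF L(1)] by (simp add: indicator_def Int_commute)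
    finally have "real (card (E \<inter> L)) \<le> maximal_rd R (indicator E) \<omega>"
      using maximal_rd_attained(2)[of \<omega> L "indicator E"] L w \<Omega> by auto
    then show ?thesis using L(3) by simp
  qed
  then have "real m * real (card \<Omega>) powr (1 / enn2real v) \<le>
      lp_norm v (refined_directions R) (maximal_rd R (indicator E))"
    using \<Omega> uv by (intro lp_norm_ge) auto
  also have "\<dots> \<le> B * real (card E) powr (1 / u)"
    using est lp_norm_indicator[OF _ E uv(1)] by simp
  finally show ?thesis .
qed

lemma critical_exponent_le:
  assumes u: "1 \<le> u" and v: "1 \<le> v"
    and est: "\<And>F :: 'a \<times> 'a \<times> 'a \<Rightarrow> complex. lp_norm v (refined_directions R) (maximal_rd R F) \<le>
      B * lp_norm (ennreal u) (carrier (heisenberg R)) F"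
  shows "q powr critical_exponent (1 / u) (1 / enn2real v) \<le> B"
proof -
  let ?\<delta> = "1 / enn2real v"
  have q: "q > 0" using order_ge_2 by simp
  note bound = incidence_bound[OF u v est]
  define S where "S = (\<lambda>(b, c). slope_dir b c) ` (K \<times> K)"
  have S: "S \<noteq> {}" "S \<subseteq> refined_directions R" "real (card S) = q powr 2"
    using q by (auto simp: S_def refined_directions_eq card_slope_dirs powr_numeral)
  have cancel: "q powr (a - b) \<le> B" if "q powr a \<le> B * q powr b" for a b
    using that q by (simp add: powr_diff field_simps)
  \<comment> \<open>The whole group has \<open>q\<^sup>3\<close> points and meets each line of the
    \<open>q\<^sup>2\<close> slope directions in \<open>q\<close> points.\<close>
  have all: "q powr (1 + 2 * ?\<delta> - 3 * (1 / u)) \<le> B"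
  proof -
    have "q * real (card S) powr ?\<delta> \<le> B * real (card (K \<times> K \<times> K)) powr (1 / u)"
    proof (rule bound[OF S(1,2)])
      fix w assume "w \<in> S"
      then obtain b c where bc: "b \<in> K" "c \<in> K" "w = slope_dir b c" by (auto simp: S_def)
      have "slope_line b c \<zero> \<in> horizontal_lines R" by (intro slope_line_horizontal bc zero_closed)
      moreover from this have "card (K \<times> K \<times> K \<inter> slope_line b c \<zero>) = order R"
        using horizontal_line_subset card_horizontal_line by (simp add: Int_absorb1)
      ultimately show "\<exists>L\<in>horizontal_lines R. Dir R L = w \<and> order R \<le> card (K \<times> K \<times> K \<inter> L)"
        using bc Dir_slope_line[of b c \<zero>] by auto
    qed simp
    moreover have "real (card (K \<times> K \<times> K)) = q powr 3"
      using q by (simp add: card_cartesian_product powr_numeral power3_eq_cube)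
    ultimately have "q * q powr (2 * ?\<delta>) \<le> B * q powr (3 * (1 / u))"
      by (simp only: S powr_powr)
    then have "q powr (1 + 2 * ?\<delta>) \<le> B * q powr (3 * (1 / u))"
      using q by (simp add: powr_add)
    then show ?thesis by (rule cancel)
  qed
  \<comment> \<open>The origin lies on the \<open>q\<close> slope lines with
    \<open>c = t = 0\<close>, one for each \<open>b\<close>.\<close>
  have point: "q powr ?\<delta> \<le> B"
  proof -
    define T where "T = (\<lambda>b. slope_dir b \<zero>) ` K"
    have "inj_on (\<lambda>b. slope_dir b \<zero>) K" using slope_dir_inject by (meson inj_onI zero_closed)
    then have T: "T \<noteq> {}" "T \<subseteq> refined_directions R" "card T = order R"
      by (auto simp: T_def refined_directions_eq card_image)
    have "real 1 * real (card T) powr ?\<delta> \<le> B * real (card {(\<zero>, \<zero>, \<zero>)}) powr (1 / u)"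
    proof (rule bound[OF T(1,2)])
      fix w assume "w \<in> T"
      then obtain b where b: "b \<in> K" "w = slope_dir b \<zero>" by (auto simp: T_def)
      have "(\<zero>, \<zero>, \<zero>) \<in> slope_line b \<zero> \<zero>"
        unfolding slope_line_def using b by (intro image_eqI[of _ _ \<zero>]) (auto simp: minus_eq)
      then have "{(\<zero>, \<zero>, \<zero>)} \<inter> slope_line b \<zero> \<zero> = {(\<zero>, \<zero>, \<zero>)}" by auto
      then show "\<exists>L\<in>horizontal_lines R. Dir R L = w \<and> 1 \<le> card ({(\<zero>, \<zero>, \<zero>)} \<inter> L)"
        using b slope_line_horizontal[of b \<zero> \<zero>] Dir_slope_line[of b \<zero> \<zero>] by (metis card_1_singleton_iff One_nat_def order_refl zero_closed)
    qed simp
    then show ?thesis by (simp add: T)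
  qed
  define V where "V = vertical_line \<zero> \<zero>"
  have V: "V \<in> horizontal_lines R" "V \<subseteq> K \<times> K \<times> K" "card V = order R" "Dir R V = vertical_dir \<zero>"
    unfolding V_def using horizontal_line_subset card_horizontal_line vertical_line_horizontal[of \<zero> \<zero>]
    by (auto simp: Dir_vertical_line)
  \<comment> \<open>A line tested on its own direction alone.\<close>
  have line: "q powr (1 - 1 / u) \<le> B"
  proof -
    have "real (order R) * real (card {vertical_dir \<zero>}) powr ?\<delta> \<le> B * real (card V) powr (1 / u)"
      using V by (intro bound) (auto simp: refined_directions_eq)
    then have "q powr 1 \<le> B * q powr (1 / u)" using q by (simp add: V)
    then show ?thesis by (rule cancel)
  qed
  \<comment> \<open>The line \<open>V\<close> consists of the points \<open>(0, s, 0)\<close>. The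
    slope line of parameters \<open>b\<close>, \<open>c\<close> and height 0 meets it at
    \<open>(0, c, 0)\<close>, so its \<open>q\<close> points serve \<open>q\<^sup>2\<close>
    directions.\<close>
  have transversals: "q powr (2 * ?\<delta> - 1 / u) \<le> B"
  proof -
    have "real 1 * real (card S) powr ?\<delta> \<le> B * real (card V) powr (1 / u)"
    proof (rule bound[OF S(1,2)])
      fix w assume "w \<in> S"
      then obtain b c where bc: "b \<in> K" "c \<in> K" "w = slope_dir b c" by (auto simp: S_def)
      have "(\<zero>, c, \<zero>) \<in> slope_line b c \<zero>"
        unfolding slope_line_def using bc by (intro image_eqI[of _ _ \<zero>]) (auto simp: minus_eq)
      moreover have "(\<zero>, c, \<zero>) \<in> V"
        unfolding V_def vertical_line_def using bc by (intro image_eqI[of _ _ c]) auto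
      moreover have fin: "finite (V \<inter> slope_line b c \<zero>)" using finite_horizontal_line V(1) by blast
      ultimately have "1 \<le> card (V \<inter> slope_line b c \<zero>)"
        by (metis IntI One_nat_def Suc_leI card_gt_0_iff empty_iff)
      then show "\<exists>L\<in>horizontal_lines R. Dir R L = w \<and> 1 \<le> card (V \<inter> L)"
        using bc slope_line_horizontal[of b c \<zero>] Dir_slope_line[of b c \<zero>] by auto
    qed (use V in simp)
    then have "q powr (2 * ?\<delta>) \<le> B * q powr (1 / u)"
      by (simp only: S(3) V(3) powr_powr of_nat_1 mult_1)
    then show ?thesis by (rule cancel)
  qed
  show ?thesis
    using all point line transversals by (auto simp: critical_exponent_def max_def)
qed

end

section \<open>Prime fields and attainment of the least exponent\<close>

lemma finite_fieldI: "odd_finite_field R \<Longrightarrow> finite_field R"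
  by (simp add: odd_finite_field_def finite_field_def finite_field_axioms_def)

text \<open>The integers modulo \<open>p\<close> are carried to natural numbers along
  \<open>nat\<close>, which is injective on the representatives \<open>0, ..., p - 1\<close>. This
  provides arbitrarily large fields of the kind quantified over in
  \<open>maximal_estimate\<close>.\<close>

lemma odd_prime_field_exists:
  assumes "prime p" "odd p"
  shows "\<exists>R :: nat ring. odd_finite_field R \<and> order R = p"
proof -
  interpret residues_prime p "residue_ring (int p)" by unfold_locales (use assms in auto)
  have inj: "inj_on nat (carrier (residue_ring (int p)))"
    by (auto simp: res_carrier_eq intro!: inj_onI)
  define R :: "nat ring" where "R = image_ring nat (residue_ring (int p))"
  have "field R" unfolding R_def by (rule inj_imp_image_ring_is_field[OF inj])
  moreover have "carrier R = nat ` carrier (residue_ring (int p))"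
    by (simp add: R_def image_ring_carrier)
  moreover have "card (nat ` carrier (residue_ring (int p))) = p"
    by (subst card_image[OF inj]) (simp add: res_carrier_eq)
  ultimately have "odd_finite_field R \<and> order R = p"
    using assms by (simp add: odd_finite_field_def order_def)
  then show ?thesis ..
qed

text \<open>The critical exponent is admissible with constant 14. An admissible \<open>A\<close>
  below it would keep a fixed positive power of \<open>p\<close> bounded over all odd primes
  \<open>p\<close>. So it is the minimum, and the estimate holds at \<open>A_rd\<close>
  itself.\<close>

lemma maximal_estimate_A_rd:
  assumes u: "1 \<le> u" and v: "1 \<le> v"
  shows "maximal_estimate (ennreal u) v (A_rd (ennreal u) v)"
proof -
  let ?A = "critical_exponent (1 / u) (1 / enn2real v)"
  have est: "maximal_estimate (ennreal u) v ?A"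
    unfolding maximal_estimate_def
    by (intro exI[of _ "14::real"] conjI allI impI
        finite_field.lp_norm_maximal_rd_le_critical[OF finite_fieldI u v]) auto
  have "0 \<le> ?A" by (simp add: critical_exponent_def le_max_iff_disj)
  moreover have "?A \<le> A" if A: "maximal_estimate (ennreal u) v A" for A
  proof (rule ccontr)
    assume "\<not> ?A \<le> A"
    then have gap: "0 < ?A - A" by simp
    obtain C where C: "C > 0" "\<And>(R :: nat ring) F. odd_finite_field R \<Longrightarrow>
        lp_norm v (refined_directions R) (maximal_rd R F) \<le>
        C * real (order R) powr A * lp_norm (ennreal u) (carrier (heisenberg R)) F"
      using A unfolding maximal_estimate_def by blast
    have bounded: "real p powr (?A - A) \<le> C" if p: "prime p" "odd p" for p
    proof -
      obtain R :: "nat ring" where R: "odd_finite_field R" "order R = p"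
        using odd_prime_field_exists[OF p] by blast
      have "real p powr ?A \<le> C * real p powr A"
        using finite_field.critical_exponent_le[OF finite_fieldI[OF R(1)] u v C(2)[OF R(1)]] R(2) by simp
      then show ?thesis using prime_gt_0_nat[OF p(1)] by (simp add: powr_diff field_simps)
    qed
    \<comment> \<open>The bound 2 makes the prime odd; the other bound makes
      \<open>p powr (?A - A)\<close> exceed \<open>C\<close>.\<close>
    obtain p where p: "prime p" "p > max 2 (nat \<lceil>C powr (1 / (?A - A))\<rceil>)"
      using bigger_prime by blast
    then have "odd p" using prime_odd_nat[of p] by simp
    have "C powr (1 / (?A - A)) < real p" using p by linarith
    then have "(C powr (1 / (?A - A))) powr (?A - A) < real p powr (?A - A)"
      using gap by (intro powr_less_mono2) auto
    then show False using bounded[OF p(1) \<open>odd p\<close>] gap C(1) by (simp add: powr_powr)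
  qed
  ultimately have "A_rd (ennreal u) v = ?A"
    unfolding A_rd_def using est by (intro Least_equality) auto
  then show ?thesis using est by simp
qed

theorem theorem1p8:
  "(\<forall>(u::real) (v::ennreal). 1 \<le> u \<longrightarrow> 1 \<le> v \<longrightarrow>
      (\<exists>c>0. \<forall>(R :: nat ring) \<Omega> E (m::nat).
        odd_finite_field R \<longrightarrow> \<Omega> \<noteq> {} \<longrightarrow> \<Omega> \<subseteq> refined_directions R \<longrightarrow>
        E \<subseteq> carrier (heisenberg R) \<longrightarrow> 1 \<le> m \<longrightarrow> m \<le> order R \<longrightarrow>
        (\<forall>\<omega>\<in>\<Omega>. \<exists>L\<in>horizontal_lines R. Dir R L = \<omega> \<and> m \<le> card (E \<inter> L)) \<longrightarrow>
        real (card E) \<ge> c * real m powr u * real (card \<Omega>) powr enn2real (ennreal u / v)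
                          * real (order R) powr (- u * A_rd (ennreal u) v)))
   \<and> (\<exists>c>0. \<forall>(R :: nat ring) \<Omega> E (m::nat).
        odd_finite_field R \<longrightarrow> \<Omega> \<noteq> {} \<longrightarrow> \<Omega> \<subseteq> refined_directions R \<longrightarrow>
        E \<subseteq> carrier (heisenberg R) \<longrightarrow> 1 \<le> m \<longrightarrow> m \<le> order R \<longrightarrow>
        (\<forall>\<omega>\<in>\<Omega>. \<exists>L\<in>horizontal_lines R. Dir R L = \<omega> \<and> m \<le> card (E \<inter> L)) \<longrightarrow>
        real (card E) \<ge> c * (real m ^ 2 * real (card \<Omega>) / real (order R)))
   \<and> (\<exists>c>0. \<forall>(R :: nat ring) E.
        odd_finite_field R \<longrightarrow> full_direction_Kakeya R E \<longrightarrow>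
        real (card E) \<ge> c * real (order R) ^ 3)"
  (is "(\<forall>u v. _ \<longrightarrow> _ \<longrightarrow> ?P u v) \<and> ?Q \<and> ?S")
proof (intro conjI allI impI)
  fix u :: real and v :: ennreal
  assume u: "1 \<le> u" and v: "1 \<le> v"
  let ?A = "A_rd (ennreal u) v"
  obtain C where C: "C > 0" "\<And>(R :: nat ring) F. odd_finite_field R \<Longrightarrow>
      lp_norm v (refined_directions R) (maximal_rd R F) \<le>
      C * real (order R) powr ?A * lp_norm (ennreal u) (carrier (heisenberg R)) F"
    using maximal_estimate_A_rd[OF u v] unfolding maximal_estimate_def by blast
  \<comment> \<open>At \<open>v = \<infinity>\<close> both sides are 0: the left as a quotient by
    infinity, the right through \<open>enn2real \<infinity> = 0\<close> and
    \<open>1 / 0 = 0\<close>.\<close>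
  have exponent: "enn2real (ennreal u / v) = u * (1 / enn2real v)"
    using u v by (cases v) (auto simp: divide_ennreal)
  show "?P u v"
  \<comment> \<open>The constant results from raising the incidence bound to the power
    \<open>u\<close> and solving for the size of \<open>E\<close>.\<close>
  proof (intro exI[of _ "C powr (- u)"] conjI allI impI)
    fix R :: "nat ring" and \<Omega> E and m :: nat
    assume R: "odd_finite_field R" and \<Omega>: "\<Omega> \<noteq> {}" "\<Omega> \<subseteq> refined_directions R"
      and E: "E \<subseteq> carrier (heisenberg R)"
      and lines: "\<forall>\<omega>\<in>\<Omega>. \<exists>L\<in>horizontal_lines R. Dir R L = \<omega> \<and> m \<le> card (E \<inter> L)"
    interpret finite_field R using R by (rule finite_fieldI)
    have q: "q > 0" using order_ge_2 by simp
    have "real m * real (card \<Omega>) powr (1 / enn2real v) \<le> C * q powr ?A * real (card E) powr (1 / u)"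
      using lines by (intro incidence_bound[OF u v C(2)[OF R] \<Omega> E]) auto
    then have "(real m * real (card \<Omega>) powr (1 / enn2real v)) powr u \<le>
        (C * q powr ?A * real (card E) powr (1 / u)) powr u"
      using u by (intro powr_mono2) auto
    then have "real m powr u * real (card \<Omega>) powr (u * (1 / enn2real v)) \<le>
        C powr u * q powr (u * ?A) * real (card E)"
      using u C(1) q by (simp add: powr_mult powr_powr mult.commute)
    then have "C powr (- u) * q powr (- u * ?A) * (real m powr u * real (card \<Omega>) powr (u * (1 / enn2real v))) \<le>
        C powr (- u) * q powr (- u * ?A) * (C powr u * q powr (u * ?A) * real (card E))"
      by (intro mult_left_mono) auto
    also have "\<dots> = real (card E)"
      using C(1) q by (simp add: powr_minus field_simps)
    finally show "real (card E) \<ge> C powr (- u) * real m powr u * real (card \<Omega>) powr enn2real (ennreal u / v)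
        * real (order R) powr (- u * ?A)"
      by (simp add: exponent mult_ac)
  qed (use C(1) in simp)
next
  \<comment> \<open>The square-sum estimate is used directly, with the explicit constant 7; squaring
    the incidence bound turns it into 49.\<close>
  have two: "real (card E) \<ge> 1 / 49 * (real m ^ 2 * real (card \<Omega>) / real (order R))"
    if R: "odd_finite_field R" and \<Omega>: "\<Omega> \<noteq> {}" "\<Omega> \<subseteq> refined_directions R"
      and E: "E \<subseteq> carrier (heisenberg R)"
      and lines: "\<forall>\<omega>\<in>\<Omega>. \<exists>L\<in>horizontal_lines R. Dir R L = \<omega> \<and> m \<le> card (E \<inter> L)"
    for R :: "nat ring" and \<Omega> E and m :: nat
  proof -
    interpret finite_field R using R by (rule finite_fieldI)
    have q: "q > 0" using order_ge_2 by simp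
    have est: "lp_norm (ennreal 2) (refined_directions R) (maximal_rd R F) \<le>
        7 * q powr (1 / 2) * lp_norm (ennreal 2) (carrier (heisenberg R)) F" for F
      using maximal_rd_estimate_le_2[of 2 F] by simp
    have "real m * real (card \<Omega>) powr (1 / enn2real (ennreal 2)) \<le>
        7 * q powr (1 / 2) * real (card E) powr (1 / 2)"
      using lines by (intro incidence_bound[OF _ _ est \<Omega> E]) auto
    then have "real m * sqrt (real (card \<Omega>)) \<le> 7 * sqrt q * sqrt (real (card E))"
      by (simp add: powr_half_sqrt)
    then have "(real m * sqrt (real (card \<Omega>)))\<^sup>2 \<le> (7 * sqrt q * sqrt (real (card E)))\<^sup>2"
      by (intro power_mono) auto
    then have "real m ^ 2 * real (card \<Omega>) \<le> 49 * q * real (card E)"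
      by (simp add: power_mult_distrib)
    then show ?thesis using q by (simp add: field_simps)
  qed
  then show ?Q by (intro exI[of _ "1 / 49 :: real"]) auto
  show ?S
  proof (intro exI[of _ "1 / 49 :: real"] conjI allI impI)
    fix R :: "nat ring" and E
    assume R: "odd_finite_field R" and E: "full_direction_Kakeya R E"
    interpret finite_field R using R by (rule finite_fieldI)
    have q: "q > 0" using order_ge_2 by simp
    have E': "E \<subseteq> carrier (heisenberg R)" using E by (simp add: full_direction_Kakeya_def)
    \<comment> \<open>A line contained in \<open>E\<close> meets it in all its \<open>q\<close>
      points, so the previous bound applies with \<open>m = q\<close> and all directions, of which
      there are at least \<open>q\<^sup>2\<close>.\<close>
    have "\<forall>\<omega>\<in>refined_directions R. \<exists>L\<in>horizontal_lines R. Dir R L = \<omega> \<and> order R \<le> card (E \<inter> L)"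
    proof
      fix w assume "w \<in> refined_directions R"
      then obtain L where "L \<in> horizontal_lines R" "L \<subseteq> E" "Dir R L = w"
        using E unfolding full_direction_Kakeya_def by blast
      then show "\<exists>L\<in>horizontal_lines R. Dir R L = w \<and> order R \<le> card (E \<inter> L)"
        by (intro bexI[of _ L]) (simp_all add: Int_absorb1 card_horizontal_line)
    qed
    from two[OF R refined_directions_nonempty order_refl E' this]
    have "1 / 49 * (q ^ 2 * real (card (refined_directions R)) / q) \<le> real (card E)" .
    moreover have "q ^ 2 \<le> real (card (refined_directions R))"
      using card_refined_directions(1) by (metis of_nat_le_iff of_nat_power)
    then have "q ^ 2 * q ^ 2 / q \<le> q ^ 2 * real (card (refined_directions R)) / q"
      by (intro divide_right_mono mult_left_mono) auto
    moreover have "q ^ 2 * q ^ 2 / q = q ^ 3"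
      using q by (simp add: field_simps power2_eq_square power3_eq_cube)
    ultimately show "real (card E) \<ge> 1 / 49 * q ^ 3" by linarith
  qed simp
qed

end
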